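(* Suppose $(M_n)_{n\ge0}$ is a nonanalytic weight sequence and $\phi$ is an inner function in $D(\bar\Delta,M)$. Then $\phi$ does not induce an endomorphism of $D(\bar\Delta,M)$ unless $\phi$ is a constant or a rotation.
   Context: $\Delta$ is the open unit disc in $\mathbb{C}$ and $\bar\Delta$ the closed unit disc. A function $f:\bar\Delta\to\mathbb{C}$ is complex-differentiable at $a\in\bar\Delta$ if $f'(a)=\lim_{z\to a,\ z\in\bar\Delta}\frac{f(z)-f(a)}{z-a}$ exists; higher derivatives $f^{(n)}$ are defined by iteration, and $D^\infty(\bar\Delta)$ is the set of infinitely complex-differentiable functions on $\bar\Delta$. $\|\cdot\|_\infty$ is the sup norm over $\bar\Delta$. A weight sequence is a sequence $(M_n)_{n\ge0}$ of positive numbers with $M_0=1$ and $\binom{m+n}{n}\le\frac{M_{m+n}}{M_mM_n}$ for all $m,n\ge0$. It is nonanalytic if $\lim_{n\to\infty}(n!/M_n)^{1/n}=0$. Define $D(\bar\Delta,M)=\{f\in D^\infty(\bar\Delta):\|f\|_{D(\bar\Delta,M)}=\sum_{n=0}^\infty\frac{\|f^{(n)}\|_\infty}{M_n}<\infty\}$, a Banach algebra under pointwise operations. A map $\phi:\bar\Delta\to\bar\Delta$ induces an endomorphism of $D(\bar\Delta,M)$ if $f\circ\phi\in D(\bar\Delta,M)$ for all $f\in D(\bar\Delta,M)$. An inner function is an analytic function $\phi$ on $\Delta$ with $|\phi(z)|\le1$ on $\Delta$ and $|\phi(e^{i\theta})|=1$ for almost all $\theta$. A rotation is a map $z\mapsto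 e^{i\theta}z$ with $\theta$ real. *)

theory Defs
  imports "HOL-Analysis.Analysis"
begin

text \<open>
  A function on the closed unit disc is represented by a total function
  \<^typ>\<open>complex \<Rightarrow> complex\<close>; nothing below depends on its values outside
  \<^term>\<open>cball (0::complex) 1\<close>.
\<close>

text \<open>
  The library's \<^const>\<open>deriv\<close> is two-sided, hence unsuitable at boundary points. The description
  is unique wherever a derivative exists, since every point of the closed disc is a limit point of it.
\<close>

definition disc_deriv :: "(complex \<Rightarrow> complex) \<Rightarrow> complex \<Rightarrow> complex" where
  "disc_deriv f a = (THE D. (f has_field_derivative D) (at a within cball 0 1))"

definition Dinf_disc :: "(complex \<Rightarrow> complex) set" where
  "Dinf_disc = {f. \<forall>n. \<forall>a\<in>cball 0 1. \<exists>D.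
     ((disc_deriv ^^ n) f has_field_derivative D) (at a within cball 0 1)}"

text \<open>
  Only applied to continuous functions on the (compact) closed disc, for which the supremum
  is a genuine one.
\<close>

definition disc_sup_norm :: "(complex \<Rightarrow> complex) \<Rightarrow> real" where
  "disc_sup_norm f = (SUP z\<in>cball 0 1. norm (f z))"

definition weight_sequence :: "(nat \<Rightarrow> real) \<Rightarrow> bool" where
  "weight_sequence M \<longleftrightarrow>
     (\<forall>n. 0 < M n) \<and> M 0 = 1 \<and>
     (\<forall>m n. real ((m + n) choose n) \<le> M (m + n) / (M m * M n))"

definition nonanalytic :: "(nat \<Rightarrow> real) \<Rightarrow> bool" where
  "nonanalytic M \<longleftrightarrow> (\<lambda>n. root n (fact n / M n)) \<longlonglongrightarrow> 0"

definition D_disc :: "(nat \<Rightarrow> real) \<Rightarrow> (complex \<Rightarrow> complex) set" where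
  "D_disc M = {f \<in> Dinf_disc. summable (\<lambda>n. disc_sup_norm ((disc_deriv ^^ n) f) / M n)}"

definition induces_endomorphism :: "(nat \<Rightarrow> real) \<Rightarrow> (complex \<Rightarrow> complex) \<Rightarrow> bool" where
  "induces_endomorphism M \<phi> \<longleftrightarrow>
     \<phi> ` cball 0 1 \<subseteq> cball 0 1 \<and> (\<forall>f\<in>D_disc M. f \<circ> \<phi> \<in> D_disc M)"

text \<open>
  An inner function lives on the open disc, so its boundary values are radial limits. For a function
  that is continuous on the closed disc they are its actual values on the unit circle.
\<close>

definition inner_function :: "(complex \<Rightarrow> complex) \<Rightarrow> bool" where
  "inner_function \<phi> \<longleftrightarrow>
     \<phi> holomorphic_on ball 0 1 \<and>
     (\<forall>z\<in>ball 0 1. norm (\<phi> z) \<le> 1) \<and>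
     (AE \<theta> in lebesgue. \<exists>w. norm w = 1 \<and>
        ((\<lambda>r. \<phi> (complex_of_real r * cis \<theta>)) \<longlongrightarrow> w) (at_left 1))"

definition is_rotation :: "(complex \<Rightarrow> complex) \<Rightarrow> bool" where
  "is_rotation \<phi> \<longleftrightarrow> (\<exists>\<theta>::real. \<forall>z\<in>cball 0 1. \<phi> z = cis \<theta> * z)"

end

theory Submission
  imports Defs "HOL-Complex_Analysis.Complex_Analysis"
begin

text \<open>
  Since \<open>\<phi>\<close> extends continuously to the circle, it is unimodular there. If it is neither constant nor a
  rotation, then \<open>\<bar>\<phi>'\<bar>\<close> exceeds 1 at some point \<open>a\<close> of the circle
  (\<open>expanding_boundary_point\<close>, a consequence of the maximum principle and Schwarz's lemma). By
  Schwarz reflection \<open>\<phi>\<close> is analytic at \<open>a\<close>, so the derivatives \<open>\<phi>\<^sup>(\<^sup>j\<^sup>)(a) / j!\<close> grow at most geometrically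
  (\<open>boundary_derivative_bounds\<close>).

  Let \<open>\<beta>\<close> be the conjugate of \<open>\<phi>(a)\<close>. The functions \<open>e\<^sub>t(z) = exp (t(\<beta>z - 1))\<close> have norm \<open>G(t) = \<Sum> t\<^sup>n / M\<^sub>n\<close>, and
  nonanalyticity implies that this sum is concentrated on \<open>n \<le> \<delta>t\<close>, for every \<open>\<delta> > 0\<close>. In that range the
  composite \<open>e\<^sub>t \<circ> \<phi>\<close> has \<open>n\<close>-th derivative of modulus at least \<open>(ct)\<^sup>n\<close> at \<open>a\<close>, for any fixed \<open>c\<close> between 1 and \<open>\<bar>\<phi>'(a)\<bar>\<close> and
  all \<open>\<delta>\<close> small enough (\<open>recurrence_lower_bound\<close>): each derivative is, in modulus, at least
  \<open>ct\<close> times the one before. As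
  \<open>G(t)\<close> has terms of arbitrarily high order, the factors \<open>c\<^sup>n\<close> make the quotient of the norms of \<open>e\<^sub>t \<circ> \<phi>\<close> and \<open>e\<^sub>t\<close>
  unbounded (\<open>peak_exp_compose_growth\<close>).

  If \<open>\<phi>\<close> induced an endomorphism, the closed graph theorem would now give a contradiction. It is
  replaced by an explicit construction: a gliding hump (\<open>gliding_hump\<close>) produces a summable
  combination of the normalised functions \<open>e\<^sub>t / G(t)\<close> that belongs to the algebra and whose composite with \<open>\<phi>\<close>
  does not, because its weighted derivatives at \<open>a\<close> are not summable.
\<close>

section \<open>Differentiation on the closed disc\<close>

lemma disc_deriv_eq:
  assumes "(f has_field_derivative D) (at a within cball 0 1)" "a \<in> cball 0 1"
  shows "disc_deriv f a = D"
proof -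
  have "at a within cball 0 1 \<noteq> bot"
    using assms(2) islimpt_ball[of a 0 1] islimpt_subset[OF _ ball_subset_cball]
    by (auto simp: trivial_limit_within)
  then show ?thesis
    unfolding disc_deriv_def
    using assms(1) has_field_derivative_unique by (blast intro: the_equality)
qed

lemma Dinf_has_deriv:
  assumes "f \<in> Dinf_disc" "z \<in> cball 0 1"
  shows "((disc_deriv ^^ n) f has_field_derivative (disc_deriv ^^ Suc n) f z) (at z within cball 0 1)"
proof -
  obtain D where D: "((disc_deriv ^^ n) f has_field_derivative D) (at z within cball 0 1)"
    using assms unfolding Dinf_disc_def by blast
  show ?thesis
    using D disc_deriv_eq[OF D assms(2)] by simp
qed

lemma Dinf_continuous_on:
  assumes "f \<in> Dinf_disc"
  shows "continuous_on (cball 0 1) ((disc_deriv ^^ n) f)"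
  using Dinf_has_deriv[OF assms] by (meson DERIV_continuous_on)

lemma Dinf_disc_deriv:
  assumes "f \<in> Dinf_disc"
  shows "disc_deriv f \<in> Dinf_disc"
proof -
  have "(disc_deriv ^^ n) (disc_deriv f) = (disc_deriv ^^ Suc n) f" for n
    by (simp only: funpow_Suc_right o_apply)
  then show ?thesis
    using Dinf_has_deriv[OF assms] unfolding Dinf_disc_def mem_Collect_eq by metis
qed

lemma disc_deriv_cong:
  assumes "\<And>z. z \<in> cball 0 1 \<Longrightarrow> f z = g z" "a \<in> cball 0 1"
  shows "disc_deriv f a = disc_deriv g a"
proof -
  have "(f has_field_derivative D) (at a within cball 0 1) =
        (g has_field_derivative D) (at a within cball 0 1)" for D
    using assms by (intro has_field_derivative_cong_eventually)
      (auto simp: eventually_at_topological)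
  then show ?thesis by (simp add: disc_deriv_def)
qed

lemma disc_deriv_pow_cong:
  assumes "\<And>z. z \<in> cball 0 1 \<Longrightarrow> f z = g z" "a \<in> cball 0 1"
  shows "(disc_deriv ^^ n) f a = (disc_deriv ^^ n) g a"
  using assms(2)
proof (induction n arbitrary: a)
  case 0 then show ?case using assms(1) by simp
next
  case (Suc n)
  then show ?case by (auto intro: disc_deriv_cong)
qed

text \<open>
  To identify all iterated derivatives of a function it suffices to exhibit a sequence of functions
  each of which is the derivative of its predecessor.
\<close>

lemma disc_deriv_family:
  assumes "\<And>n z. z \<in> cball 0 1 \<Longrightarrow>
      (d n has_field_derivative d (Suc n) z) (at z within cball 0 1)"
  shows "d 0 \<in> Dinf_disc"
    and "z \<in> cball 0 1 \<Longrightarrow> (disc_deriv ^^ n) (d 0) z = d n z"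
proof -
  have eq: "(disc_deriv ^^ n) (d 0) z = d n z" if "z \<in> cball 0 1" for n z
    using that
  proof (induction n arbitrary: z)
    case (Suc n)
    have "(disc_deriv ^^ Suc n) (d 0) z = disc_deriv (d n) z"
      using Suc by (auto intro: disc_deriv_cong)
    also have "\<dots> = d (Suc n) z"
      using assms[OF Suc.prems] Suc.prems by (rule disc_deriv_eq)
    finally show ?case .
  qed auto
  then show "z \<in> cball 0 1 \<Longrightarrow> (disc_deriv ^^ n) (d 0) z = d n z" by blast
  have "((disc_deriv ^^ n) (d 0) has_field_derivative d (Suc n) z) (at z within cball 0 1)"
    if "z \<in> cball 0 1" for n z
    using assms[OF that] zero_less_one that
    by (rule has_field_derivative_transform_within) (use eq in auto)
  then show "d 0 \<in> Dinf_disc" unfolding Dinf_disc_def by blast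
qed

lemma Dinf_cmult:
  assumes "f \<in> Dinf_disc"
  shows "(\<lambda>z. c * f z) \<in> Dinf_disc"
  using disc_deriv_family(1)[of "\<lambda>n z. c * (disc_deriv ^^ n) f z"]
    DERIV_cmult[OF Dinf_has_deriv[OF assms]] by simp

lemma disc_deriv_pow_cmult:
  assumes "f \<in> Dinf_disc" "z \<in> cball 0 1"
  shows "(disc_deriv ^^ n) (\<lambda>w. c * f w) z = c * (disc_deriv ^^ n) f z"
  using disc_deriv_family(2)[of "\<lambda>n w. c * (disc_deriv ^^ n) f w" z n]
    DERIV_cmult[OF Dinf_has_deriv[OF assms(1)]] assms(2) by simp

text \<open>
  Leibniz's rule, valid up to the boundary.
\<close>

lemma disc_deriv_pow_mult:
  assumes f: "f \<in> Dinf_disc" and g: "g \<in> Dinf_disc" and z: "z \<in> cball 0 1"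
  shows "(disc_deriv ^^ n) (\<lambda>w. f w * g w) z =
    (\<Sum>i\<le>n. of_nat (n choose i) * (disc_deriv ^^ i) f z * (disc_deriv ^^ (n - i)) g z)"
proof -
  let ?d = "\<lambda>n w. \<Sum>i\<le>n. of_nat (n choose i) * (disc_deriv ^^ i) f w * (disc_deriv ^^ (n - i)) g w"
  have "(?d n has_field_derivative ?d (Suc n) z) (at z within cball 0 1)"
    if z: "z \<in> cball 0 1" for n z
  proof -
    let ?f = "\<lambda>i. (disc_deriv ^^ i) f z" and ?g = "\<lambda>i. (disc_deriv ^^ i) g z"
    have "(?d n has_field_derivative
        (\<Sum>i\<le>n. of_nat (n choose i) * (?f (Suc i) * ?g (n - i) + ?f i * ?g (Suc (n - i)))))
        (at z within cball 0 1)"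
      by (rule derivative_eq_intros Dinf_has_deriv[OF f z] Dinf_has_deriv[OF g z] refl)+
        (simp add: algebra_simps)
    moreover have "(\<Sum>i\<le>n. of_nat (n choose i) * (?f (Suc i) * ?g (n - i) + ?f i * ?g (Suc (n - i))))
       = ?d (Suc n) z"
    proof -
      have A: "?d (Suc n) z = ?f 0 * ?g (Suc n) +
        (\<Sum>i\<le>n. of_nat (Suc n choose Suc i) * ?f (Suc i) * ?g (n - i))"
        by (subst sum.atMost_Suc_shift) simp
      have B: "(\<Sum>i\<le>n. of_nat (n choose i) * ?f i * ?g (Suc n - i)) =
          ?f 0 * ?g (Suc n) + (\<Sum>i\<le>n. of_nat (n choose Suc i) * ?f (Suc i) * ?g (n - i))"
      proof -
        have "(\<Sum>i\<le>n. of_nat (n choose i) * ?f i * ?g (Suc n - i)) =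
          (\<Sum>i\<le>Suc n. of_nat (n choose i) * ?f i * ?g (Suc n - i))" by simp
        also have "\<dots> = ?f 0 * ?g (Suc n) + (\<Sum>i\<le>n. of_nat (n choose Suc i) * ?f (Suc i) * ?g (n - i))"
          by (subst sum.atMost_Suc_shift) simp
        finally show ?thesis .
      qed
      have C: "(\<Sum>i\<le>n. of_nat (n choose i) * (?f i * ?g (Suc (n - i)))) =
          (\<Sum>i\<le>n. of_nat (n choose i) * ?f i * ?g (Suc n - i))"
        by (rule sum.cong) (auto simp: Suc_diff_le)
      show ?thesis
        unfolding A using B C by (simp add: algebra_simps sum.distrib)
    qed
    ultimately show ?thesis by simp
  qed
  from disc_deriv_family(2)[of ?d, OF this z] show ?thesis by simp
qed

text \<open>
  The point may lie on the unit circle: a function that extends holomorphically across a boundary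
  point has the derivatives of the extension there.
\<close>

lemma disc_deriv_pow_holomorphic:
  assumes hol: "\<Phi> holomorphic_on ball a r"
    and eq: "\<And>z. z \<in> cball 0 1 \<Longrightarrow> z \<in> ball a r \<Longrightarrow> f z = \<Phi> z"
    and "z \<in> cball 0 1" "z \<in> ball a r"
  shows "(disc_deriv ^^ n) f z = (deriv ^^ n) \<Phi> z"
  using assms(3,4)
proof (induction n arbitrary: z)
  case 0 then show ?case using eq by simp
next
  case (Suc n)
  obtain d where d: "d > 0" "ball z d \<subseteq> ball a r"
    using Suc.prems openE[of "ball a r" z] by auto
  have "((deriv ^^ n) \<Phi> has_field_derivative deriv ((deriv ^^ n) \<Phi>) z) (at z)"
    using has_field_derivative_higher_deriv[OF hol open_ball] Suc.prems by auto
  then have "((deriv ^^ n) \<Phi> has_field_derivative (deriv ^^ Suc n) \<Phi> z) (at z within cball 0 1)"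
    by (simp add: has_field_derivative_at_within)
  then have "((disc_deriv ^^ n) f has_field_derivative (deriv ^^ Suc n) \<Phi> z) (at z within cball 0 1)"
    by (rule has_field_derivative_transform_within[OF _ d(1) Suc.prems(1)])
      (metis Suc.IH d(2) dist_commute mem_ball subsetD)
  from disc_deriv_eq[OF this Suc.prems(1)] show ?case by simp
qed

lemma Dinf_bdd:
  assumes "f \<in> Dinf_disc"
  shows "bdd_above ((\<lambda>z. norm ((disc_deriv ^^ n) f z)) ` cball 0 1)"
  by (intro bounded_imp_bdd_above compact_imp_bounded compact_continuous_image
      continuous_intros Dinf_continuous_on assms) auto

lemma norm_le_disc_sup_norm:
  assumes "f \<in> Dinf_disc" "z \<in> cball 0 1"
  shows "norm ((disc_deriv ^^ n) f z) \<le> disc_sup_norm ((disc_deriv ^^ n) f)"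
  unfolding disc_sup_norm_def using Dinf_bdd[OF assms(1)] assms(2) by (rule cSUP_upper2) simp

lemma disc_sup_norm_le:
  assumes "\<And>z. z \<in> cball 0 1 \<Longrightarrow> norm (f z) \<le> B"
  shows "disc_sup_norm f \<le> B"
  unfolding disc_sup_norm_def by (rule cSUP_least) (use assms in auto)

text \<open>
  Termwise differentiation under bounds that are uniform in the index but may grow arbitrarily
  with the order of differentiation.
\<close>

lemma disc_deriv_pow_suminf:
  fixes g :: "nat \<Rightarrow> complex \<Rightarrow> complex" and \<alpha> :: "nat \<Rightarrow> real"
  assumes g: "\<And>j. g j \<in> Dinf_disc"
    and K: "\<And>n j z. z \<in> cball 0 1 \<Longrightarrow> norm ((disc_deriv ^^ n) (g j) z) \<le> K n"
    and \<alpha>: "\<And>j. 0 \<le> \<alpha> j" "summable \<alpha>"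
  shows "(\<lambda>z. \<Sum>j. of_real (\<alpha> j) * g j z) \<in> Dinf_disc"
    and "z \<in> cball 0 1 \<Longrightarrow> (disc_deriv ^^ n) (\<lambda>z. \<Sum>j. of_real (\<alpha> j) * g j z) z =
          (\<Sum>j. of_real (\<alpha> j) * (disc_deriv ^^ n) (g j) z)"
proof -
  let ?d = "\<lambda>n z. \<Sum>j. of_real (\<alpha> j) * (disc_deriv ^^ n) (g j) z"
  have bd: "norm (of_real (\<alpha> j) * (disc_deriv ^^ n) (g j) z) \<le> \<alpha> j * K n"
    if "z \<in> cball 0 1" for n j z
    using K[OF that] \<alpha>(1) by (auto simp: norm_mult intro: mult_left_mono)
  have sm: "summable (\<lambda>j. \<alpha> j * K n)" for n
    using \<alpha>(2) by (rule summable_mult2)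
  have "(?d n has_field_derivative ?d (Suc n) z) (at z within cball 0 1)"
    if z: "z \<in> cball 0 1" for n z
  proof -
    have "\<exists>h. \<forall>x\<in>cball 0 1. (\<lambda>j. of_real (\<alpha> j) * (disc_deriv ^^ n) (g j) x) sums h x \<and>
        (h has_field_derivative ?d (Suc n) x) (at x within cball 0 1)"
    proof (rule has_field_derivative_series)
      show "((\<lambda>w. of_real (\<alpha> j) * (disc_deriv ^^ n) (g j) w) has_field_derivative
          of_real (\<alpha> j) * (disc_deriv ^^ Suc n) (g j) x) (at x within cball 0 1)"
        if "x \<in> cball 0 1" for j x
        using Dinf_has_deriv[OF g that] by (rule DERIV_cmult)
      show "uniform_limit (cball 0 1)
         (\<lambda>m x. \<Sum>i<m. of_real (\<alpha> i) * (disc_deriv ^^ Suc n) (g i) x) (?d (Suc n)) sequentially"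
        by (rule Weierstrass_m_test[OF bd sm])
      show "summable (\<lambda>j. of_real (\<alpha> j) * (disc_deriv ^^ n) (g j) z)"
        by (rule summable_comparison_test'[OF sm bd[OF z]])
    qed (use z in auto)
    then obtain h where h: "\<And>x. x \<in> cball 0 1 \<Longrightarrow> (\<lambda>j. of_real (\<alpha> j) * (disc_deriv ^^ n) (g j) x) sums h x"
       "\<And>x. x \<in> cball 0 1 \<Longrightarrow> (h has_field_derivative ?d (Suc n) x) (at x within cball 0 1)"
      by blast
    show ?thesis
      using h(2)[OF z] zero_less_one z
      by (rule has_field_derivative_transform_within) (use h(1) sums_unique in blast)
  qed
  note * = disc_deriv_family[of ?d, OF this]
  from * show "(\<lambda>z. \<Sum>j. of_real (\<alpha> j) * g j z) \<in> Dinf_disc" by simp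
  from *(2) show "z \<in> cball 0 1 \<Longrightarrow> (disc_deriv ^^ n) (\<lambda>z. \<Sum>j. of_real (\<alpha> j) * g j z) z =
          (\<Sum>j. of_real (\<alpha> j) * (disc_deriv ^^ n) (g j) z)" by simp
qed

lemma D_discI:
  assumes f: "f \<in> Dinf_disc" and M: "\<And>n. 0 < M n" and s: "summable s"
    and le: "\<And>n z. z \<in> cball 0 1 \<Longrightarrow> norm ((disc_deriv ^^ n) f z) \<le> M n * s n"
  shows "f \<in> D_disc M"
proof -
  have "summable (\<lambda>n. disc_sup_norm ((disc_deriv ^^ n) f) / M n)"
  proof (rule summable_comparison_test'[OF s, of 0])
    fix n
    have "0 \<le> disc_sup_norm ((disc_deriv ^^ n) f)"
      by (rule order_trans[OF norm_ge_zero norm_le_disc_sup_norm[OF f, of 0 n]]) simp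
    moreover have "disc_sup_norm ((disc_deriv ^^ n) f) \<le> M n * s n"
      by (rule disc_sup_norm_le[OF le])
    ultimately show "norm (disc_sup_norm ((disc_deriv ^^ n) f) / M n) \<le> s n"
      using M[of n] by (simp add: field_simps)
  qed
  with f show ?thesis by (simp add: D_disc_def)
qed

lemma D_disc_summable_at:
  assumes "f \<in> D_disc M" and M: "\<And>n. 0 < M n" and z: "z \<in> cball 0 1"
  shows "summable (\<lambda>n. norm ((disc_deriv ^^ n) f z) / M n)"
proof -
  have f: "f \<in> Dinf_disc" and s: "summable (\<lambda>n. disc_sup_norm ((disc_deriv ^^ n) f) / M n)"
    using assms(1) by (auto simp: D_disc_def)
  show ?thesis
    by (rule summable_comparison_test'[OF s, of 0])
      (use norm_le_disc_sup_norm[OF f z] M in \<open>simp add: divide_right_mono less_imp_le\<close>)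
qed

text \<open>
  The norm of the algebra. It is meaningful on \<^term>\<open>D_disc M\<close>, where the series converges.
\<close>

definition D_disc_norm :: "(nat \<Rightarrow> real) \<Rightarrow> (complex \<Rightarrow> complex) \<Rightarrow> real" where
  "D_disc_norm M f = (\<Sum>n. disc_sup_norm ((disc_deriv ^^ n) f) / M n)"

text \<open>
  The instance of completeness that is needed: a nonnegative summable combination of elements of
  the unit ball of the algebra stays in the algebra.
\<close>

lemma D_disc_suminf:
  fixes g :: "nat \<Rightarrow> complex \<Rightarrow> complex" and \<alpha> :: "nat \<Rightarrow> real"
  assumes M: "\<And>n. 0 < M n" and g: "\<And>j. g j \<in> D_disc M" "\<And>j. D_disc_norm M (g j) \<le> 1"
    and \<alpha>: "\<And>j. 0 \<le> \<alpha> j" "summable \<alpha>"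
  shows "(\<lambda>z. \<Sum>j. of_real (\<alpha> j) * g j z) \<in> D_disc M"
proof -
  define w where "w j n = disc_sup_norm ((disc_deriv ^^ n) (g j)) / M n" for j n
  have gD: "g j \<in> Dinf_disc" and sw: "summable (w j)" and w1: "suminf (w j) \<le> 1" for j
    using g[of j] by (auto simp: D_disc_def D_disc_norm_def w_def[abs_def])
  have gw: "norm ((disc_deriv ^^ n) (g j) z) \<le> M n * w j n" if "z \<in> cball 0 1" for n j z
    using norm_le_disc_sup_norm[OF gD that] less_imp_neq[OF M[of n]] by (simp add: w_def)
  have w0: "0 \<le> w j n" for j n
  proof -
    have "0 \<le> M n * w j n" by (rule order_trans[OF norm_ge_zero gw[of 0]]) simp
    then show ?thesis using M[of n] by (simp add: zero_le_mult_iff)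
  qed
  have sumw: "(\<Sum>n\<in>A. w j n) \<le> 1" if "finite A" for A j
    using sum_le_suminf[OF sw that] w0 w1[of j] by (meson order_trans)
  have wle: "w j n \<le> 1" for j n using sumw[of "{n}" j] by simp
  have K: "norm ((disc_deriv ^^ n) (g j) z) \<le> M n" if "z \<in> cball 0 1" for n j z
    using order_trans[OF gw[OF that] mult_left_le[OF wle less_imp_le[OF M]]] .
  have series: "(\<lambda>z. \<Sum>j. of_real (\<alpha> j) * g j z) \<in> Dinf_disc"
    by (rule disc_deriv_pow_suminf(1)[of g M \<alpha>, OF gD K \<alpha>])
  have dseries: "(disc_deriv ^^ n) (\<lambda>z. \<Sum>j. of_real (\<alpha> j) * g j z) z =
      (\<Sum>j. of_real (\<alpha> j) * (disc_deriv ^^ n) (g j) z)" if "z \<in> cball 0 1" for n z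
    by (rule disc_deriv_pow_suminf(2)[of g M \<alpha>, OF gD K \<alpha> that])
  define s where "s n = (\<Sum>j. \<alpha> j * w j n)" for n
  have sm: "summable (\<lambda>j. \<alpha> j * w j n)" for n
  proof (rule summable_comparison_test'[OF \<alpha>(2), of 0])
    fix j show "norm (\<alpha> j * w j n) \<le> \<alpha> j"
      using mult_left_le[OF wle \<alpha>(1)] \<alpha>(1) w0 by simp
  qed
  show ?thesis
  proof (rule D_discI[OF series M])
    show "summable s"
    proof (rule summableI_nonneg_bounded)
      show "0 \<le> s n" for n unfolding s_def by (intro suminf_nonneg sm mult_nonneg_nonneg \<alpha> w0)
      show "(\<Sum>n<N. s n) \<le> (\<Sum>j. \<alpha> j)" for N
      proof -
        have "(\<Sum>n<N. s n) = (\<Sum>j. \<Sum>n<N. \<alpha> j * w j n)"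
          unfolding s_def by (rule suminf_sum[symmetric]) (rule sm)
        also have "\<dots> \<le> (\<Sum>j. \<alpha> j)"
        proof (rule suminf_le[OF _ summable_sum[OF sm] \<alpha>(2)])
          show "(\<Sum>n<N. \<alpha> j * w j n) \<le> \<alpha> j" for j
            using mult_left_le[OF sumw \<alpha>(1)] by (simp add: sum_distrib_left[symmetric])
        qed
        finally show ?thesis .
      qed
    qed
    fix n z assume z: "z \<in> cball (0::complex) 1"
    have bnd: "norm (of_real (\<alpha> j) * (disc_deriv ^^ n) (g j) z) \<le> M n * (\<alpha> j * w j n)" for j
      using mult_left_mono[OF gw[OF z, of n j] \<alpha>(1)[of j]] \<alpha>(1)[of j] by (simp add: norm_mult mult_ac)
    have "norm (\<Sum>j. of_real (\<alpha> j) * (disc_deriv ^^ n) (g j) z) \<le> (\<Sum>j. M n * (\<alpha> j * w j n))"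
      by (rule norm_suminf_le[OF bnd summable_mult[OF sm]])
    then show "norm ((disc_deriv ^^ n) (\<lambda>z. \<Sum>j. of_real (\<alpha> j) * g j z) z) \<le> M n * s n"
      unfolding dseries[OF z] s_def suminf_mult[OF sm] .
  qed
qed

section \<open>The gliding hump\<close>

text \<open>
  A uniform boundedness principle for operators between spaces of absolutely summable sequences:
  if the rows of a matrix are summable but not bounded in the summable norm, while each column is
  bounded, then the matrix maps some summable sequence, supported on suitably chosen rows, outside
  the summable sequences. The rows are picked one at a time. The coefficient of a new row is so small
  that the row is negligible on the finite block of columns used before; the row is then so
  large that, on an initial block of columns, it dominates everything chosen earlier.
\<close>

lemma gliding_hump:
  fixes x :: "nat \<Rightarrow> nat \<Rightarrow> complex"
  assumes S: "\<And>k. summable (\<lambda>n. norm (x k n))"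
    and B: "\<And>k n. norm (x k n) \<le> B n"
    and unb: "\<And>L. \<exists>k. L \<le> (\<Sum>n. norm (x k n))"
  obtains \<alpha> :: "nat \<Rightarrow> real" and k :: "nat \<Rightarrow> nat"
  where "\<And>j. 0 \<le> \<alpha> j" "summable \<alpha>"
    "\<not> summable (\<lambda>n. norm (\<Sum>j. of_real (\<alpha> j) * x (k j) n))"
proof -
  have B0: "0 \<le> B n" for n using B[of 0 n] norm_ge_zero order_trans by blast
  define T where "T k = (\<Sum>n. norm (x k n))" for k
  \<comment> \<open>A state consists of the current row, the length of its block of columns, its coefficient, and the
      total weighted norm of all rows chosen so far.\<close>
  define P :: "nat \<Rightarrow> nat \<times> nat \<times> real \<times> real \<Rightarrow> bool" where
    "P n = (\<lambda>(k, N, \<alpha>, A). 0 < \<alpha> \<and> \<alpha> \<le> (1/2) ^ n \<and> (n = 0 \<longrightarrow> A = \<alpha> * T k))" for n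
  define Q :: "nat \<Rightarrow> nat \<times> nat \<times> real \<times> real \<Rightarrow> nat \<times> nat \<times> real \<times> real \<Rightarrow> bool" where
    "Q n = (\<lambda>(k, N, \<alpha>, A) (k', N', \<alpha>', A'). N \<le> N' \<and> \<alpha>' * (\<Sum>n<N. B n) \<le> (1/2) ^ Suc n \<and>
       A' = A + \<alpha>' * T k' \<and> real n + 1 + A \<le> \<alpha>' * (\<Sum>n<N'. norm (x k' n)))" for n
  have "\<exists>f. \<forall>n. P n (f n) \<and> Q n (f n) (f (Suc n))"
  proof (rule dependent_nat_choice)
    show "\<exists>s. P 0 s" by (rule exI[of _ "(0, 0, 1, 1 * T 0)"]) (simp add: P_def)
  next
    fix s n assume "P n s"
    obtain k N \<alpha> A where s: "s = (k, N, \<alpha>, A)" by (cases s)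
    define \<alpha>' where "\<alpha>' = (1/2) ^ Suc n / (1 + (\<Sum>n<N. B n))"
    have D0: "0 \<le> (\<Sum>n<N. B n)" using B0 by (simp add: sum_nonneg)
    have a: "0 < \<alpha>'" "\<alpha>' \<le> (1/2) ^ Suc n" "\<alpha>' * (\<Sum>n<N. B n) \<le> (1/2) ^ Suc n"
    proof -
      show "0 < \<alpha>'" unfolding \<alpha>'_def using D0 by simp
      show "\<alpha>' \<le> (1/2) ^ Suc n"
        unfolding \<alpha>'_def using D0 divide_left_mono[of 1 "1 + (\<Sum>n<N. B n)" "(1/2) ^ Suc n :: real"] by simp
      have "(\<Sum>n<N. B n) / (1 + (\<Sum>n<N. B n)) \<le> 1" using D0 by simp
      then have "(1/2) ^ Suc n * ((\<Sum>n<N. B n) / (1 + (\<Sum>n<N. B n))) \<le> (1/2::real) ^ Suc n"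
        by (intro mult_left_le) auto
      then show "\<alpha>' * (\<Sum>n<N. B n) \<le> (1/2) ^ Suc n" unfolding \<alpha>'_def by simp
    qed
    define L where "L = (real n + 1 + A) / \<alpha>'"
    obtain k' where k': "L + 1 \<le> T k'" using unb T_def by metis
    have "(\<lambda>m. \<Sum>n<m. norm (x k' n)) \<longlonglongrightarrow> T k'"
      unfolding T_def using summable_LIMSEQ[OF S] .
    then have "\<forall>\<^sub>F m in sequentially. L < (\<Sum>n<m. norm (x k' n))"
      by (rule order_tendstoD(1)) (use k' in auto)
    then obtain N1 where N1: "\<And>m. m \<ge> N1 \<Longrightarrow> L < (\<Sum>n<m. norm (x k' n))"
      by (auto simp: eventually_sequentially)
    define N' where "N' = max N N1"
    have "L \<le> (\<Sum>n<N'. norm (x k' n))" using N1[of N'] by (simp add: N'_def)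
    then have "\<alpha>' * L \<le> \<alpha>' * (\<Sum>n<N'. norm (x k' n))"
      using a(1) by (intro mult_left_mono) auto
    then have "real n + 1 + A \<le> \<alpha>' * (\<Sum>n<N'. norm (x k' n))"
      unfolding L_def using a(1) by simp
    then show "\<exists>y. P (Suc n) y \<and> Q n s y"
      using a by (intro exI[of _ "(k', N', \<alpha>', A + \<alpha>' * T k')"])
        (auto simp: P_def Q_def s N'_def)
  qed
  then obtain f where f: "\<And>n. P n (f n)" "\<And>n. Q n (f n) (f (Suc n))" by blast
  define k where "k n = fst (f n)" for n
  define N where "N n = fst (snd (f n))" for n
  define \<alpha> where "\<alpha> n = fst (snd (snd (f n)))" for n
  define A where "A n = snd (snd (snd (f n)))" for n
  have fe: "f n = (k n, N n, \<alpha> n, A n)" for n by (simp add: k_def N_def \<alpha>_def A_def)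
  have \<alpha>: "0 < \<alpha> n" "\<alpha> n \<le> (1/2) ^ n" for n using f(1)[of n] by (auto simp: P_def fe)
  have NS: "N n \<le> N (Suc n)" and BS: "\<alpha> (Suc n) * (\<Sum>i<N n. B i) \<le> (1/2) ^ Suc n"
    and AS: "A (Suc n) = A n + \<alpha> (Suc n) * T (k (Suc n))"
    and LS: "real n + 1 + A n \<le> \<alpha> (Suc n) * (\<Sum>i<N (Suc n). norm (x (k (Suc n)) i))" for n
    using f(2)[of n] by (auto simp: Q_def fe)
  have A: "A n = (\<Sum>i\<le>n. \<alpha> i * T (k i))" for n
  proof (induction n)
    case 0 then show ?case using f(1)[of 0] by (simp add: P_def fe)
  qed (simp add: AS)
  have Nmono: "m \<le> n \<Longrightarrow> N m \<le> N n" for m n using NS by (rule lift_Suc_mono_le)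
  have sg: "summable (\<lambda>n. (1/2::real) ^ n)" by simp
  have s\<alpha>: "summable \<alpha>"
    by (rule summable_comparison_test'[OF sg, of 0]) (use \<alpha> in \<open>auto simp: abs_of_pos\<close>)
  define y where "y i n = of_real (\<alpha> i) * x (k i) n" for i n
  have ny: "norm (y i n) = \<alpha> i * norm (x (k i) n)" for i n
    using \<alpha>(1)[of i] by (simp add: y_def norm_mult)
  have sy: "summable (\<lambda>i. norm (y i n))" for n
  proof (rule summable_comparison_test'[OF summable_mult2[OF s\<alpha>, of "B n"], of 0])
    fix i show "norm (norm (y i n)) \<le> \<alpha> i * B n"
      using B \<alpha>(1)[of i] by (simp add: ny mult_left_mono)
  qed
  have sys: "summable (\<lambda>i. norm (y (i + m) n))" for m n
    using sy by (rule summable_ignore_initial_segment)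
  have hump: "real j \<le> (\<Sum>n<N (Suc j). norm (\<Sum>i. y i n))" for j
  proof -
    let ?N = "N (Suc j)"
    \<comment> \<open>The block of the row just chosen: its own mass minus that of the earlier and of the later rows.\<close>
    have pt: "norm (y (Suc j) n) - (\<Sum>i\<le>j. norm (y i n)) - (\<Sum>i. norm (y (i + Suc (Suc j)) n))
        \<le> norm (\<Sum>i. y i n)" for n
    proof -
      have "(\<Sum>i. y i n) = (\<Sum>i. y (i + Suc (Suc j)) n) + (\<Sum>i<Suc (Suc j). y i n)"
        using suminf_split_initial_segment[OF summable_norm_cancel[OF sy]] .
      also have "(\<Sum>i<Suc (Suc j). y i n) = (\<Sum>i\<le>j. y i n) + y (Suc j) n"
        by (simp add: lessThan_Suc_atMost)
      finally have e: "y (Suc j) n = (\<Sum>i. y i n) - (\<Sum>i. y (i + Suc (Suc j)) n) - (\<Sum>i\<le>j. y i n)"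
        by simp
      have "norm (y (Suc j) n) \<le> norm (\<Sum>i. y i n) + norm (\<Sum>i. y (i + Suc (Suc j)) n) + norm (\<Sum>i\<le>j. y i n)"
        unfolding e by (meson norm_triangle_ineq4 order_trans add_mono order_refl)
      moreover have "norm (\<Sum>i. y (i + Suc (Suc j)) n) \<le> (\<Sum>i. norm (y (i + Suc (Suc j)) n))"
        by (rule summable_norm[OF sys])
      moreover have "norm (\<Sum>i\<le>j. y i n) \<le> (\<Sum>i\<le>j. norm (y i n))" by (rule norm_sum)
      ultimately show ?thesis by linarith
    qed
    have 1: "real j + 1 + A j \<le> (\<Sum>n<?N. norm (y (Suc j) n))"
      using LS[of j] by (simp add: ny sum_distrib_left)
    have 2: "(\<Sum>n<?N. \<Sum>i\<le>j. norm (y i n)) \<le> A j"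
    proof -
      have "(\<Sum>n<?N. \<Sum>i\<le>j. norm (y i n)) = (\<Sum>i\<le>j. \<alpha> i * (\<Sum>n<?N. norm (x (k i) n)))"
        by (subst sum.swap) (simp add: ny sum_distrib_left)
      also have "\<dots> \<le> (\<Sum>i\<le>j. \<alpha> i * T (k i))"
        unfolding T_def using \<alpha>(1) S
        by (intro sum_mono mult_left_mono sum_le_suminf) (auto simp: less_imp_le)
      finally show ?thesis by (simp add: A)
    qed
    have 3: "(\<Sum>n<?N. \<Sum>i. norm (y (i + Suc (Suc j)) n)) \<le> 1"
    proof -
      have "(\<Sum>n<?N. \<Sum>i. norm (y (i + Suc (Suc j)) n)) = (\<Sum>i. \<Sum>n<?N. norm (y (i + Suc (Suc j)) n))"
        by (rule suminf_sum[symmetric, OF sys])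
      also have "\<dots> \<le> (\<Sum>i. (1/2) ^ Suc i)"
      proof (rule suminf_le)
        fix i
        let ?m = "i + Suc j"
        have "(\<Sum>n<?N. norm (y (Suc ?m) n)) \<le> \<alpha> (Suc ?m) * (\<Sum>n<?N. B n)"
          unfolding ny sum_distrib_left[symmetric] using \<alpha>(1)[of "Suc ?m"] B
          by (intro mult_left_mono sum_mono) auto
        also have "\<dots> \<le> \<alpha> (Suc ?m) * (\<Sum>n<N ?m. B n)"
          using \<alpha>(1)[of "Suc ?m"] B0 Nmono[of "Suc j" ?m]
          by (intro mult_left_mono sum_mono2) auto
        also have "\<dots> \<le> (1/2) ^ Suc ?m" by (rule BS)
        also have "\<dots> \<le> (1/2) ^ Suc i" by (rule power_decreasing) auto
        finally show "(\<Sum>n<?N. norm (y (i + Suc (Suc j)) n)) \<le> (1/2) ^ Suc i" by simp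
      next
        show "summable (\<lambda>i. \<Sum>n<?N. norm (y (i + Suc (Suc j)) n))"
          by (rule summable_sum[OF sys])
      qed (use power_half_series sums_summable in blast)
      also have "\<dots> = 1" using power_half_series by (simp add: sums_iff)
      finally show ?thesis .
    qed
    have "(\<Sum>n<?N. norm (y (Suc j) n) - (\<Sum>i\<le>j. norm (y i n)) - (\<Sum>i. norm (y (i + Suc (Suc j)) n)))
        \<le> (\<Sum>n<?N. norm (\<Sum>i. y i n))" by (intro sum_mono pt)
    then show ?thesis using 1 2 3 by (simp add: sum_subtractf)
  qed
  have "\<not> summable (\<lambda>n. norm (\<Sum>i. y i n))"
  proof
    assume sm: "summable (\<lambda>n. norm (\<Sum>i. y i n))"
    obtain j where "(\<Sum>n. norm (\<Sum>i. y i n)) < real j" using reals_Archimedean2 by blast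
    moreover have "real j \<le> (\<Sum>n. norm (\<Sum>i. y i n))"
      using hump[of j] sum_le_suminf[OF sm, of "{..<N (Suc j)}"] by simp
    ultimately show False by simp
  qed
  then show thesis
    using that[of \<alpha> k] \<alpha>(1) s\<alpha> by (simp add: y_def less_imp_le)
qed

section \<open>Boundary behaviour of inner functions\<close>

text \<open>
  Continuity upgrades the almost everywhere statement: the exceptional set is open and null.
\<close>

lemma inner_function_unimodular:
  assumes inner: "inner_function \<phi>" and cont: "continuous_on (cball 0 1) \<phi>" and a: "norm a = 1"
  shows "norm (\<phi> a) = 1"
proof -
  define S where "S = {\<theta>. norm (\<phi> (cis \<theta>)) \<noteq> 1}"
  have contc: "continuous_on UNIV (\<lambda>\<theta>. norm (\<phi> (cis \<theta>)))"
    by (intro continuous_on_norm continuous_on_compose2[OF cont] continuous_intros) auto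
  have "open S"
    unfolding S_def using contc by (intro open_Collect_neq) auto
  have rad: "norm (\<phi> (cis \<theta>)) = 1"
    if w: "norm w = 1" "((\<lambda>r. \<phi> (complex_of_real r * cis \<theta>)) \<longlongrightarrow> w) (at_left 1)" for \<theta> w
  proof -
    have "continuous_on {0..1} (\<lambda>r. \<phi> (complex_of_real r * cis \<theta>))"
      by (intro continuous_on_compose2[OF cont] continuous_intros) (auto simp: norm_mult)
    then have "((\<lambda>r. \<phi> (complex_of_real r * cis \<theta>)) \<longlongrightarrow> \<phi> (complex_of_real 1 * cis \<theta>)) (at 1 within {0..1})"
      unfolding continuous_on by (elim bspec) auto
    then have "((\<lambda>r. \<phi> (complex_of_real r * cis \<theta>)) \<longlongrightarrow> \<phi> (cis \<theta>)) (at_left 1)"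
      using at_within_Icc_at_left[of 0 "1::real"] by simp
    with w(2) have "w = \<phi> (cis \<theta>)" by (intro tendsto_unique) auto
    with w(1) show ?thesis by simp
  qed
  have "AE \<theta> in lebesgue. \<theta> \<notin> S"
    using inner unfolding inner_function_def S_def
    by (auto elim!: eventually_mono dest: rad)
  then have "negligible S"
    by (simp add: AE_iff_null_sets negligible_iff_null_sets \<open>open S\<close> borel_open)
  then have "S = {}" using open_not_negligible \<open>open S\<close> by blast
  moreover have "a = cis (Arg a)" using a rcis_cmod_Arg[of a] by (simp add: rcis_def)
  ultimately show ?thesis unfolding S_def by (metis (mono_tags, lifting) empty_Collect_eq)
qed

text \<open>
  If the derivative were bounded by 1 on the circle, it would be so on the disc, and comparing a point
  with its radial projection to the circle would give a lower bound for the function by the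
  modulus of the variable. Then either the function has no zero and its reciprocal is also bounded by 1,
  so it is constant, or it vanishes at the origin and the equality case of Schwarz's lemma makes it a
  rotation.
\<close>

lemma expanding_boundary_point:
  assumes hol: "\<phi> holomorphic_on ball 0 1" and D: "\<phi> \<in> Dinf_disc"
    and le: "\<And>z. z \<in> cball 0 1 \<Longrightarrow> norm (\<phi> z) \<le> 1"
    and uni: "\<And>z. norm z = 1 \<Longrightarrow> norm (\<phi> z) = 1"
    and nc: "\<not> \<phi> constant_on cball 0 1" and nr: "\<not> is_rotation \<phi>"
  obtains a where "norm a = 1" "1 < norm (disc_deriv \<phi> a)"
proof (rule ccontr)
  assume "\<not> thesis"
  then have b: "norm (disc_deriv \<phi> a) \<le> 1" if "norm a = 1" for a
    using that \<open>\<And>a. cmod a = 1 \<Longrightarrow> 1 < cmod (disc_deriv \<phi> a) \<Longrightarrow> thesis\<close> not_less by blast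
  have cont: "continuous_on (cball 0 1) \<phi>" "continuous_on (cball 0 1) (disc_deriv \<phi>)"
    using Dinf_continuous_on[OF D, of 0] Dinf_continuous_on[OF D, of 1] by auto
  have der: "(\<phi> has_field_derivative disc_deriv \<phi> z) (at z within cball 0 1)" if "z \<in> cball 0 1" for z
    using Dinf_has_deriv[OF D that, of 0] by simp
  have holD: "disc_deriv \<phi> holomorphic_on ball 0 1"
  proof -
    have "disc_deriv \<phi> z = deriv \<phi> z" if "z \<in> ball 0 1" for z
      using disc_deriv_pow_holomorphic[OF hol refl, of z 1] that by simp
    then show ?thesis
      by (intro holomorphic_transform[OF holomorphic_deriv[OF hol open_ball]]) simp
  qed
  have b1: "norm (disc_deriv \<phi> z) \<le> 1" if "z \<in> cball 0 1" for z
  proof (rule maximum_modulus_frontier[where S = "cball 0 1" and f = "disc_deriv \<phi>"])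
    show "disc_deriv \<phi> holomorphic_on interior (cball 0 1)" using holD by simp
    show "continuous_on (closure (cball 0 1)) (disc_deriv \<phi>)" using cont(2) by simp
    show "norm (disc_deriv \<phi> w) \<le> 1" if "w \<in> frontier (cball 0 1)" for w
      using that by (intro b) simp
  qed (use that in simp_all)
  have lip: "norm (\<phi> z - \<phi> w) \<le> norm (z - w)" if "z \<in> cball 0 1" "w \<in> cball 0 1" for z w
    using field_differentiable_bound[of "cball 0 1" \<phi> "disc_deriv \<phi>" 1 z w] der b1 that by auto
  have low: "norm z \<le> norm (\<phi> z)" if z: "z \<in> cball 0 1" for z
  proof -
    \<comment> \<open>The radial projection of the point; at the origin any point of the circle will do.\<close>
    define a where "a = (if z = 0 then 1 else sgn z)"
    have a: "norm a = 1" by (simp add: a_def norm_sgn)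
    have za: "z = of_real (norm z) * a" by (simp add: a_def sgn_eq)
    have "a - z = of_real (1 - norm z) * a"
      using za by (simp add: left_diff_distrib)
    then have "norm (a - z) = \<bar>1 - norm z\<bar>" using a by (simp only: norm_mult norm_of_real mult_1_right)
    then have "norm (a - z) = 1 - norm z" using z by simp
    moreover have "norm (\<phi> a) - norm (\<phi> z) \<le> norm (a - z)"
      using lip[of a z] a z norm_triangle_ineq2[of "\<phi> a" "\<phi> z"] by simp
    ultimately show ?thesis using uni[OF a] by simp
  qed
  show False
  proof (cases "\<phi> 0 = 0")
    case False
    then have nz: "\<phi> z \<noteq> 0" if "z \<in> cball 0 1" for z using low[OF that] by (cases "z = 0") auto
    have inv: "norm (inverse (\<phi> z)) \<le> 1" if "z \<in> cball 0 1" for z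
    proof (rule maximum_modulus_frontier[where S = "cball 0 1" and f = "\<lambda>z. inverse (\<phi> z)"])
      show "(\<lambda>z. inverse (\<phi> z)) holomorphic_on interior (cball 0 1)"
        using hol nz by (auto simp: interior_cball intro!: holomorphic_intros)
      show "continuous_on (closure (cball 0 1)) (\<lambda>z. inverse (\<phi> z))"
        using cont nz by (auto intro!: continuous_intros)
    qed (use uni that in \<open>auto simp: norm_inverse\<close>)
    have one: "norm (\<phi> z) = 1" if "z \<in> cball 0 1" for z
    proof -
      have "1 \<le> norm (\<phi> z)" using inv[OF that] nz[OF that] by (simp add: norm_inverse inverse_le_1_iff)
      then show ?thesis using le[OF that] by simp
    qed
    have "\<phi> constant_on ball 0 1"
    proof (rule maximum_modulus_principle[where S = "ball 0 1" and U = "ball 0 1" and \<xi> = 0])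
      show "norm (\<phi> z) \<le> norm (\<phi> 0)" if "z \<in> ball 0 1" for z
        using that by (simp add: one)
    qed (use hol in simp_all)
    then have "\<phi> constant_on closure (ball 0 1)"
      by (rule constant_on_closureI) (simp add: cont)
    then show False using nc by simp
  next
    case True
    have lt: "norm (\<phi> z) < 1" if "norm z < 1" for z
    proof -
      have "norm (\<phi> z - \<phi> 0) \<le> norm (z - 0)" using lip[of z 0] that by simp
      then show ?thesis using True that by simp
    qed
    have "norm (\<phi> (1/2)) \<le> norm (1/2::complex)"
      using lip[of "1/2" 0] True by simp
    then have "norm (\<phi> (1/2)) = norm (1/2::complex)" using low[of "1/2"] by simp
    then obtain w where w: "\<And>z. norm z < 1 \<Longrightarrow> \<phi> z = w * z" "norm w = 1"
    proof -
      have "norm (1/2 :: complex) < 1" "(1/2 :: complex) \<noteq> 0" by simp_all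
      then have "\<exists>z. norm z < 1 \<and> z \<noteq> 0 \<and> norm (\<phi> z) = norm z"
        using \<open>norm (\<phi> (1/2)) = norm (1/2::complex)\<close> by blast
      then show thesis
        using Schwarz_Lemma(3)[of \<phi> 0] hol True lt that by auto
    qed
    have "\<phi> z - w * z = 0" if "z \<in> cball 0 1" for z
    proof (rule continuous_constant_on_closure[where S = "ball 0 1" and f = "\<lambda>z. \<phi> z - w * z"])
      show "continuous_on (closure (ball 0 1)) (\<lambda>z. \<phi> z - w * z)"
        using cont by (auto intro!: continuous_intros)
    qed (use that w in auto)
    moreover have "w = cis (Arg w)" using w(2) rcis_cmod_Arg[of w] by (simp add: rcis_def)
    ultimately have "\<forall>z\<in>cball 0 1. \<phi> z = cis (Arg w) * z" by (metis eq_iff_diff_eq_0)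
    then have "is_rotation \<phi>" unfolding is_rotation_def by (rule exI)
    then show False using nr by simp
  qed
qed

text \<open>
  The map \<open>\<zeta> \<mapsto> a * exp (\<i> * \<zeta>)\<close> carries the upper half plane into the disc and the real axis to the
  circle, and \<open>h\<close> is the function read in this coordinate on both sides: it is real on the real axis, so
  Schwarz reflection in the line applies.
\<close>

lemma local_reflection:
  assumes hol: "\<phi> holomorphic_on ball 0 1" and cont: "continuous_on (cball 0 1) \<phi>"
    and uni: "\<And>z. norm z = 1 \<Longrightarrow> norm (\<phi> z) = 1" and a: "norm a = 1"
  obtains r \<Phi> where "r > 0" "\<Phi> holomorphic_on ball a r"
    "\<And>z. z \<in> cball 0 1 \<Longrightarrow> z \<in> ball a r \<Longrightarrow> \<phi> z = \<Phi> z"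
proof -
  define b where "b = \<phi> a"
  have b: "norm b = 1" using uni[OF a] by (simp add: b_def)
  have nz: "a \<noteq> 0" "b \<noteq> 0" using a b by auto
  define q where "q \<zeta> = \<phi> (a * exp (\<i> * \<zeta>)) / b" for \<zeta>
  have nexp: "norm (a * exp (\<i> * \<zeta>)) = exp (- Im \<zeta>)" for \<zeta> using a by (simp add: norm_mult)
  have cq: "continuous_on {\<zeta>. 0 \<le> Im \<zeta>} q"
    unfolding q_def using nz
    by (intro continuous_intros continuous_on_compose2[OF cont]) (auto simp: nexp)
  have "q 0 = 1" using nz by (simp add: q_def b_def)
  then obtain e where e: "e > 0" "\<And>\<zeta>. 0 \<le> Im \<zeta> \<Longrightarrow> norm \<zeta> < e \<Longrightarrow> norm (q \<zeta> - 1) < 1"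
    using cq[unfolded continuous_on_iff, rule_format, of 0 1] by (auto simp: dist_norm)
  have qpos: "q \<zeta> \<notin> \<real>\<^sub>\<le>\<^sub>0" if "0 \<le> Im \<zeta>" "norm \<zeta> < e" for \<zeta>
  proof -
    have "Re (1 - q \<zeta>) < 1"
      using e(2)[OF that] complex_Re_le_cmod[of "1 - q \<zeta>"] by (simp add: norm_minus_commute)
    then show ?thesis by (auto simp: complex_nonpos_Reals_iff)
  qed
  define h where "h \<zeta> = - \<i> * Ln (q \<zeta>)" for \<zeta>
  define H where "H \<zeta> = (if 0 \<le> Im \<zeta> then h \<zeta> else cnj (h (cnj \<zeta>)))" for \<zeta>
  have holH: "H holomorphic_on ball 0 e"
    unfolding H_def
  proof (rule Schwarz_reflection)
    show "cnj ` ball 0 e \<subseteq> ball 0 e" by auto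
    have "q holomorphic_on (ball 0 e \<inter> {z. 0 < Im z})"
      unfolding q_def using nz
      by (intro holomorphic_intros holomorphic_on_compose_gen[OF _ hol, unfolded o_def])
        (auto simp: nexp)
    then show "h holomorphic_on (ball 0 e \<inter> {z. 0 < Im z})"
      unfolding h_def using qpos by (intro holomorphic_intros) auto
    show "continuous_on (ball 0 e \<inter> {z. 0 \<le> Im z}) h"
      unfolding h_def using qpos
      by (intro continuous_intros continuous_on_subset[OF cq]) auto
    show "h z \<in> \<real>" if "z \<in> ball 0 e" "z \<in> \<real>" for z
    proof -
      have Im: "Im z = 0" using that(2) complex_is_Real_iff by simp
      have "norm (q z) = 1" using uni[of "a * exp (\<i> * z)"] nexp[of z] Im b by (simp add: q_def norm_divide)
      moreover have "q z \<noteq> 0" using calculation by auto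
      ultimately have "Re (Ln (q z)) = 0" by (simp add: Re_Ln)
      then show ?thesis by (simp add: h_def complex_is_Real_iff)
    qed
  qed auto
  define \<Phi> where "\<Phi> z = b * exp (\<i> * H (- \<i> * Ln (z / a)))" for z
  have "continuous (at a) (\<lambda>z. - \<i> * Ln (z / a))"
    using nz by (intro continuous_intros) auto
  then obtain d where d: "d > 0" "\<And>z. dist z a < d \<Longrightarrow> norm (- \<i> * Ln (z / a)) < e"
    using e(1) nz unfolding continuous_at_eps_delta by fastforce
  define r where "r = min d 1"
  have zpos: "z / a \<notin> \<real>\<^sub>\<le>\<^sub>0" if "z \<in> ball a r" for z
  proof -
    have "norm (z / a - 1) = norm (z - a)"
      using a nz by (simp add: divide_simps norm_divide)
    then have "norm (1 - z / a) < 1" using that by (simp add: r_def dist_norm norm_minus_commute)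
    then have "Re (1 - z / a) < 1" using complex_Re_le_cmod[of "1 - z / a"] by linarith
    then show ?thesis by (auto simp: complex_nonpos_Reals_iff)
  qed
  have in_e: "- \<i> * Ln (z / a) \<in> ball 0 e" if "z \<in> ball a r" for z
    using d(2)[of z] that by (simp add: r_def dist_commute)
  show thesis
  proof
    show "r > 0" using d by (simp add: r_def)
    have "(\<lambda>z. - \<i> * Ln (z / a)) holomorphic_on ball a r"
      using zpos nz by (intro holomorphic_intros) auto
    then have "(\<lambda>z. H (- \<i> * Ln (z / a))) holomorphic_on ball a r"
      by (rule holomorphic_on_compose_gen[OF _ holH, unfolded o_def]) (use in_e in blast)
    then show "\<Phi> holomorphic_on ball a r" unfolding \<Phi>_def by (intro holomorphic_intros)
    fix z assume z: "z \<in> cball 0 1" "z \<in> ball a r"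
    define \<zeta> where "\<zeta> = - \<i> * Ln (z / a)"
    have z0: "z \<noteq> 0" using zpos[OF z(2)] by auto
    have az: "a * exp (\<i> * \<zeta>) = z" using z0 nz by (simp add: \<zeta>_def)
    have "exp (- Im \<zeta>) \<le> 1" using z(1) nexp[of \<zeta>] unfolding az by simp
    then have Im: "0 \<le> Im \<zeta>" by simp
    have "q \<zeta> \<noteq> 0" using qpos[OF Im] in_e[OF z(2)] by (auto simp: \<zeta>_def)
    moreover have "\<Phi> z = b * exp (\<i> * H \<zeta>)" by (simp only: \<Phi>_def \<zeta>_def)
    moreover have "\<i> * H \<zeta> = Ln (q \<zeta>)" using Im by (simp add: H_def h_def)
    ultimately have "\<Phi> z = b * q \<zeta>" by simp
    also have "\<dots> = \<phi> z" using nz az by (simp add: q_def)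
    finally show "\<phi> z = \<Phi> z" by simp
  qed
qed

text \<open>
  Cauchy's estimates for the local extension. The bounds have the growth of an analytic function, which
  membership in \<^term>\<open>D_disc M\<close> alone does not give.
\<close>

lemma boundary_derivative_bounds:
  assumes "\<phi> holomorphic_on ball 0 1" and "continuous_on (cball 0 1) \<phi>"
    and "\<And>z. norm z = 1 \<Longrightarrow> norm (\<phi> z) = 1" and a: "norm a = 1"
  obtains B R where "0 < R" "0 \<le> B" "\<And>j. norm ((disc_deriv ^^ j) \<phi> a) \<le> fact j * B * R ^ j"
proof -
  obtain r \<Phi> where r: "r > 0" and hol: "\<Phi> holomorphic_on ball a r"
    and eq: "\<And>z. z \<in> cball 0 1 \<Longrightarrow> z \<in> ball a r \<Longrightarrow> \<phi> z = \<Phi> z"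
    using local_reflection[OF assms] by blast
  have cont: "continuous_on (cball a (r/2)) \<Phi>"
    using r by (intro holomorphic_on_imp_continuous_on holomorphic_on_subset[OF hol]) auto
  then have "bounded (\<Phi> ` cball a (r/2))"
    by (intro compact_imp_bounded compact_continuous_image) auto
  then obtain B where B: "\<And>z. z \<in> cball a (r/2) \<Longrightarrow> norm (\<Phi> z) \<le> B"
    unfolding bounded_iff by (metis image_eqI)
  have "norm ((disc_deriv ^^ j) \<phi> a) \<le> fact j * B * (2 / r) ^ j" for j
  proof -
    have "norm ((deriv ^^ j) \<Phi> a) \<le> fact j * B / (r/2) ^ j"
      using r B cont by (intro Cauchy_inequality holomorphic_on_subset[OF hol]) (auto simp: dist_norm)
    moreover have "(disc_deriv ^^ j) \<phi> a = (deriv ^^ j) \<Phi> a"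
      using a r by (intro disc_deriv_pow_holomorphic[OF hol eq]) auto
    ultimately show ?thesis by (simp add: power_divide)
  qed
  moreover have "0 \<le> B" using r by (intro order_trans[OF norm_ge_zero B[of a]]) simp
  ultimately show thesis using r by (intro that[of "2 / r" B]) auto
qed

section \<open>Growth of the weight series\<close>

text \<open>
  The norm of the function \<open>exp (t * z)\<close> divided by its supremum \<open>exp t\<close>.
\<close>

definition weight_series :: "(nat \<Rightarrow> real) \<Rightarrow> real \<Rightarrow> real" where
  "weight_series M t = (\<Sum>n. t ^ n / M n)"

lemma nonanalytic_fact_bound:
  assumes "nonanalytic M" "\<And>n. 0 < M n" "0 < \<epsilon>"
  obtains n0 where "\<And>n. n \<ge> n0 \<Longrightarrow> fact n / M n \<le> \<epsilon> ^ n"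
proof -
  have "\<forall>\<^sub>F n in sequentially. root n (fact n / M n) < \<epsilon>"
    using assms(1,3) unfolding nonanalytic_def by (rule order_tendstoD(2))
  then obtain n0 where n0: "\<And>n. n \<ge> n0 \<Longrightarrow> root n (fact n / M n) < \<epsilon>"
    by (auto simp: eventually_sequentially)
  have "fact n / M n \<le> \<epsilon> ^ n" if n: "n \<ge> Suc n0" for n
  proof -
    have ge: "0 \<le> fact n / M n" using assms(2)[of n] by simp
    have "fact n / M n = root n (fact n / M n) ^ n"
      using ge n by (simp add: real_root_pow_pos2)
    also have "\<dots> \<le> \<epsilon> ^ n"
      using ge n n0[of n] by (intro power_mono) (auto intro: less_imp_le)
    finally show ?thesis .
  qed
  then show thesis by (rule that)
qed

lemma summable_weight_series:
  assumes "nonanalytic M" "\<And>n. 0 < M n" "0 \<le> t"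
  shows "summable (\<lambda>n. t ^ n / M n)"
proof -
  obtain n0 where n0: "\<And>n. n \<ge> n0 \<Longrightarrow> fact n / M n \<le> 1 ^ n"
    using nonanalytic_fact_bound[of M 1] assms by auto
  show ?thesis
  proof (rule summable_comparison_test'[OF summable_exp_generic[of t], of n0])
    fix n assume "n \<ge> n0"
    then have "1 / M n \<le> inverse (fact n)"
      using n0[of n] assms(2)[of n] by (simp add: field_simps)
    then show "norm (t ^ n / M n) \<le> t ^ n /\<^sub>R fact n"
      using assms(2)[of n] assms(3) mult_left_mono[of "1 / M n" "inverse (fact n)" "t ^ n"]
      by (simp add: mult_ac)
  qed
qed

lemma weight_series_ge_term:
  assumes "nonanalytic M" "\<And>n. 0 < M n" "0 \<le> t"
  shows "t ^ n / M n \<le> weight_series M t"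
  using sum_le_suminf[OF summable_weight_series[OF assms], of "{n}"] assms(2,3)
  by (auto simp: weight_series_def less_imp_le)

lemma weight_series_ge_1:
  assumes "nonanalytic M" "\<And>n. 0 < M n" "M 0 = 1" "0 \<le> t"
  shows "1 \<le> weight_series M t"
  using weight_series_ge_term[of M t 0] assms by simp

text \<open>
  Nonanalyticity in full strength: for every \<open>\<delta> > 0\<close>, however small, the terms of index beyond \<open>\<delta> * t\<close>
  are negligible for large \<open>t\<close>.
\<close>

lemma weight_series_tail:
  assumes M: "nonanalytic M" "\<And>n. 0 < M n" and "0 < \<delta>"
  obtains t0 where "\<And>t n. t \<ge> t0 \<Longrightarrow> real n > \<delta> * t \<Longrightarrow> t > 0 \<Longrightarrow> t ^ n / M n \<le> (1/2) ^ n"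
proof -
  \<comment> \<open>Chosen so that the estimate of n ^ n / fact n by exp n turns the bound into (1/2) ^ n.\<close>
  define \<epsilon> where "\<epsilon> = \<delta> / (2 * exp 1)"
  have \<epsilon>: "0 < \<epsilon>" using assms by (simp add: \<epsilon>_def)
  obtain n0 where n0: "\<And>n. n \<ge> n0 \<Longrightarrow> fact n / M n \<le> \<epsilon> ^ n"
    using nonanalytic_fact_bound[OF M \<epsilon>] by blast
  have "t ^ n / M n \<le> (1/2) ^ n" if t: "t \<ge> real n0 / \<delta>" "real n > \<delta> * t" "t > 0" for t n
  proof -
    have n: "n \<ge> n0" using t assms by (simp add: field_simps)
    have "t ^ n / M n = t ^ n / fact n * (fact n / M n)" by simp
    also have "\<dots> \<le> t ^ n / fact n * \<epsilon> ^ n"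
      using t by (intro mult_left_mono n0 n) auto
    also have "\<dots> \<le> (real n / \<delta>) ^ n / fact n * \<epsilon> ^ n"
      using t assms \<epsilon> by (intro mult_right_mono divide_right_mono power_mono) (auto simp: field_simps)
    also have "\<dots> = (real n ^ n / fact n) * (\<epsilon> / \<delta>) ^ n"
      by (simp add: power_divide)
    also have "\<dots> \<le> exp (real n) * (\<epsilon> / \<delta>) ^ n"
    proof (intro mult_right_mono)
      have "(\<Sum>k\<in>{n}. real n ^ k /\<^sub>R fact k) \<le> (\<Sum>k. real n ^ k /\<^sub>R fact k)"
        by (intro sum_le_suminf summable_exp_generic) auto
      then show "real n ^ n / fact n \<le> exp (real n)"
        by (simp add: exp_def divide_inverse mult_ac)
    qed (use \<epsilon> assms in auto)
    also have "\<dots> = (1/2) ^ n"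
      using assms by (simp add: \<epsilon>_def exp_of_nat_mult[of n 1, simplified] power_divide power_mult_distrib)
    finally show ?thesis .
  qed
  then show thesis by (rule that)
qed

text \<open>
  Rescaling the variable by a factor \<open>c > 1\<close> increases the series by an arbitrarily large factor, and this
  is already visible on the terms of index at most \<open>\<delta> * t\<close>. Indeed for large \<open>t\<close> at least half of the
  series comes from indices between \<open>m\<close> and \<open>\<delta> * t\<close>, and these terms gain at least the factor \<open>c ^ m\<close>.
\<close>

lemma weight_series_growth:
  assumes M: "nonanalytic M" "\<And>n. 0 < M n" "M 0 = 1" and "0 < \<delta>" "1 < c"
  shows "\<exists>k::nat. 0 < k \<and>
    L * weight_series M k \<le> (\<Sum>n\<le>nat \<lfloor>\<delta> * real k\<rfloor>. (c * real k) ^ n / M n)"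
proof -
  obtain t0 where t0: "\<And>t n. t \<ge> t0 \<Longrightarrow> real n > \<delta> * t \<Longrightarrow> t > 0 \<Longrightarrow> t ^ n / M n \<le> (1/2) ^ n"
    using weight_series_tail[OF M(1,2) \<open>0 < \<delta>\<close>] by blast
  obtain m where m: "2 * L \<le> c ^ m"
    using real_arch_pow[OF \<open>1 < c\<close>, of "2 * L"] by (auto intro: less_imp_le)
  define S where "S = (\<Sum>n<m. 1 / M n)"
  have S0: "0 \<le> S" unfolding S_def by (intro sum_nonneg) (use M(2) in \<open>auto intro: less_imp_le\<close>)
  obtain k :: nat where k: "real k \<ge> max (max 1 t0) (max (m / \<delta>) ((S + 2) * M m))"
    using real_arch_simple by blast
  define t where "t = real k"
  define N where "N = nat \<lfloor>\<delta> * t\<rfloor>"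
  have t: "t \<ge> 1" "t \<ge> t0" "real m \<le> \<delta> * t" "(S + 2) * M m \<le> t"
    using k \<open>0 < \<delta>\<close> by (auto simp: t_def field_simps)
  have mN: "m \<le> N" unfolding N_def using t(3) by (simp add: le_nat_floor)
  have sm: "summable (\<lambda>n. t ^ n / M n)" using summable_weight_series[OF M(1,2)] t by simp
  have pos: "0 \<le> t ^ n / M n" for n using M(2)[of n] t by simp
  define A where "A = (\<Sum>n<m. t ^ n / M n)"
  define Bm where "Bm = (\<Sum>n\<in>{m..N}. t ^ n / M n)"
  have "weight_series M t = (\<Sum>n. t ^ (n + Suc N) / M (n + Suc N)) + (\<Sum>n<Suc N. t ^ n / M n)"
    unfolding weight_series_def using suminf_split_initial_segment[OF sm] .
  moreover have "(\<Sum>n<Suc N. t ^ n / M n) = A + Bm"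
  proof -
    have "{..<Suc N} = {..<m} \<union> {m..N}" using mN by auto
    then show ?thesis unfolding A_def Bm_def by (simp add: sum.union_disjoint ivl_disj_int)
  qed
  moreover have "(\<Sum>n. t ^ (n + Suc N) / M (n + Suc N)) \<le> (\<Sum>n. (1/2) ^ Suc n)"
  proof (rule suminf_le)
    fix n
    have "real (n + Suc N) > \<delta> * t" unfolding N_def by linarith
    then have "t ^ (n + Suc N) / M (n + Suc N) \<le> (1/2) ^ (n + Suc N)"
      using t0[of t "n + Suc N"] t by linarith
    also have "\<dots> \<le> (1/2) ^ Suc n" by (rule power_decreasing) auto
    finally show "t ^ (n + Suc N) / M (n + Suc N) \<le> (1/2) ^ Suc n" .
  next
    show "summable (\<lambda>n. t ^ (n + Suc N) / M (n + Suc N))"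
      using sm by (rule summable_ignore_initial_segment)
  qed (use power_half_series sums_summable in blast)
  moreover have "(\<Sum>n. (1/2) ^ Suc n) = (1::real)" using power_half_series by (simp add: sums_iff)
  moreover have "A + 1 \<le> Bm"
  proof -
    have "A \<le> (\<Sum>n<m. t ^ m / t * (1 / M n))"
      unfolding A_def
    proof (rule sum_mono)
      fix n assume "n \<in> {..<m}"
      then have "t ^ Suc n \<le> t ^ m" using t by (intro power_increasing) auto
      then have "t ^ n \<le> t ^ m / t" using t by (simp add: field_simps)
      then show "t ^ n / M n \<le> t ^ m / t * (1 / M n)"
        using M(2)[of n] divide_right_mono[of "t ^ n" "t ^ m / t" "M n"] by simp
    qed
    also have "\<dots> = t ^ m / t * S" unfolding S_def by (rule sum_distrib_left[symmetric])
    also have "\<dots> = t ^ m * (S / t)" by simp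
    finally have A: "A \<le> t ^ m * (S / t)" .
    have "1 \<le> t ^ m" using t by simp
    show ?thesis
    proof (cases "m = 0")
      case True
      have "t ^ 0 / M 0 \<le> Bm" unfolding Bm_def
        by (rule member_le_sum) (use True pos in auto)
      then show ?thesis using True M(3) by (simp add: A_def)
    next
      case False
      have "t \<le> t ^ m" using power_increasing[of 1 m t] False t by simp
      then have "A + 1 \<le> t ^ m * (S / t) + t ^ m / t" using A t by (simp add: field_simps)
      also have "\<dots> = t ^ m * ((S + 1) / t)" by (simp add: add_divide_distrib distrib_left)
      also have "\<dots> \<le> t ^ m * (1 / M m)"
      proof (intro mult_left_mono)
        have "(S + 1) * M m \<le> (S + 2) * M m" using M(2)[of m] by (intro mult_right_mono) auto
        then show "(S + 1) / t \<le> 1 / M m" using t M(2)[of m] by (simp add: field_simps)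
      qed (use t in auto)
      also have "\<dots> \<le> Bm"
        using member_le_sum[of m "{m..N}" "\<lambda>n. t ^ n / M n"] mN pos by (simp add: Bm_def)
      finally show ?thesis .
    qed
  qed
  ultimately have G: "weight_series M t \<le> 2 * Bm" by linarith
  have "0 \<le> weight_series M t" using weight_series_ge_term[OF M(1,2), of t 0] pos[of 0] t by linarith
  then have "L * weight_series M t \<le> c ^ m / 2 * weight_series M t"
    using m by (intro mult_right_mono) auto
  also have "\<dots> \<le> c ^ m / 2 * (2 * Bm)" using G \<open>1 < c\<close> by (intro mult_left_mono) auto
  also have "\<dots> = (\<Sum>n\<in>{m..N}. c ^ m * (t ^ n / M n))" by (simp add: Bm_def sum_distrib_left)
  also have "\<dots> \<le> (\<Sum>n\<in>{m..N}. (c * t) ^ n / M n)"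
  proof (rule sum_mono)
    fix n assume "n \<in> {m..N}"
    then have "c ^ m * (t ^ n / M n) \<le> c ^ n * (t ^ n / M n)"
      using pos[of n] \<open>1 < c\<close> by (intro mult_right_mono power_increasing) auto
    then show "c ^ m * (t ^ n / M n) \<le> (c * t) ^ n / M n" by (simp add: power_mult_distrib)
  qed
  also have "\<dots> \<le> (\<Sum>n\<le>N. (c * t) ^ n / M n)"
    using t \<open>1 < c\<close> M(2) by (intro sum_mono2) (auto intro!: divide_nonneg_nonneg less_imp_le[OF M(2)])
  finally show ?thesis
    using t by (intro exI[of _ k]) (auto simp: t_def N_def)
qed

section \<open>Exponentials peaking at a boundary point and their composites\<close>

text \<open>
  For a unimodular \<open>\<beta>\<close> and \<open>t \<ge> 0\<close> this exponential has supremum 1 on the closed disc, attained at the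
  conjugate of \<open>\<beta>\<close>.
\<close>

definition peak_exp :: "complex \<Rightarrow> real \<Rightarrow> complex \<Rightarrow> complex" where
  "peak_exp \<beta> t z = exp (of_real t * (\<beta> * z - 1))"

lemma peak_exp_Dinf: "peak_exp \<beta> t \<in> Dinf_disc"
  and disc_deriv_pow_peak_exp: "z \<in> cball 0 1 \<Longrightarrow>
    (disc_deriv ^^ n) (peak_exp \<beta> t) z = (of_real t * \<beta>) ^ n * peak_exp \<beta> t z"
proof -
  let ?d = "\<lambda>n z. (of_real t * \<beta>) ^ n * peak_exp \<beta> t z"
  have "(?d n has_field_derivative ?d (Suc n) z) (at z within cball 0 1)" for n z
    unfolding peak_exp_def by (rule derivative_eq_intros refl)+ (simp add: algebra_simps)
  note * = disc_deriv_family[of ?d, OF this]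
  from * show "peak_exp \<beta> t \<in> Dinf_disc" by simp
  from *(2) show "z \<in> cball 0 1 \<Longrightarrow>
    (disc_deriv ^^ n) (peak_exp \<beta> t) z = (of_real t * \<beta>) ^ n * peak_exp \<beta> t z" by simp
qed

lemma norm_peak_exp_le:
  assumes "norm \<beta> = 1" "0 \<le> t" "norm z \<le> 1"
  shows "norm (peak_exp \<beta> t z) \<le> 1"
proof -
  have "Re (\<beta> * z) \<le> 1"
    using complex_Re_le_cmod[of "\<beta> * z"] assms by (simp add: norm_mult)
  then have "t * (Re (\<beta> * z) - 1) \<le> 0"
    using assms(2) by (intro mult_nonneg_nonpos) auto
  then show ?thesis by (simp add: peak_exp_def)
qed

lemma norm_disc_deriv_peak_exp_le:
  assumes "norm \<beta> = 1" "0 \<le> t" "z \<in> cball 0 1"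
  shows "norm ((disc_deriv ^^ n) (peak_exp \<beta> t) z) \<le> t ^ n"
  using norm_peak_exp_le[of \<beta> t z] assms
  by (simp add: disc_deriv_pow_peak_exp norm_mult norm_power mult_left_le)

lemma peak_exp_D_disc:
  assumes "nonanalytic M" and M: "\<And>n. 0 < M n" and "norm \<beta> = 1" "0 \<le> t"
  shows "peak_exp \<beta> t \<in> D_disc M"
proof (rule D_discI[OF peak_exp_Dinf M summable_weight_series[OF assms(1) M \<open>0 \<le> t\<close>]])
  fix n z assume "z \<in> cball (0::complex) 1"
  then show "norm ((disc_deriv ^^ n) (peak_exp \<beta> t) z) \<le> M n * (t ^ n / M n)"
    using norm_disc_deriv_peak_exp_le[of \<beta> t z n] assms less_imp_neq[OF M[of n]] by simp
qed

text \<open>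
  The derivative of the composite is \<open>t * \<beta> * \<phi>'\<close> times the composite; the higher derivatives follow by
  Leibniz's rule.
\<close>

lemma peak_exp_compose_rec:
  assumes \<phi>: "\<phi> \<in> Dinf_disc" and E: "peak_exp \<beta> t \<circ> \<phi> \<in> Dinf_disc" and z: "z \<in> cball 0 1"
  shows "(disc_deriv ^^ Suc n) (peak_exp \<beta> t \<circ> \<phi>) z = of_real t *
    (\<Sum>i\<le>n. of_nat (n choose i) * (\<beta> * (disc_deriv ^^ Suc i) \<phi> z) *
       (disc_deriv ^^ (n - i)) (peak_exp \<beta> t \<circ> \<phi>) z)"
proof -
  let ?E = "peak_exp \<beta> t \<circ> \<phi>"
  have 1: "disc_deriv ?E w = of_real t * \<beta> * (disc_deriv \<phi> w * ?E w)" if w: "w \<in> cball 0 1" for w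
  proof (rule disc_deriv_eq[OF _ w])
    have "(\<phi> has_field_derivative disc_deriv \<phi> w) (at w within cball 0 1)"
      using Dinf_has_deriv[OF \<phi> w, of 0] by simp
    then show "(?E has_field_derivative of_real t * \<beta> * (disc_deriv \<phi> w * ?E w)) (at w within cball 0 1)"
      unfolding peak_exp_def o_def
      by - ((rule derivative_eq_intros refl | assumption)+, simp add: algebra_simps)
  qed
  have "(disc_deriv ^^ Suc n) ?E z = (disc_deriv ^^ n) (disc_deriv ?E) z"
    by (simp only: funpow_Suc_right o_apply)
  also have "\<dots> = (disc_deriv ^^ n) (\<lambda>w. of_real t * \<beta> * (disc_deriv \<phi> w * ?E w)) z"
    by (rule disc_deriv_pow_cong[OF 1 z])
  also have "\<dots> = (disc_deriv ^^ n) (\<lambda>w. (of_real t * \<beta> * disc_deriv \<phi> w) * ?E w) z"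
    by (simp only: mult.assoc)
  also have "\<dots> = (\<Sum>i\<le>n. of_nat (n choose i) * (disc_deriv ^^ i) (\<lambda>w. of_real t * \<beta> * disc_deriv \<phi> w) z *
      (disc_deriv ^^ (n - i)) ?E z)"
  proof (rule disc_deriv_pow_mult[OF _ E z])
    show "(\<lambda>w. of_real t * \<beta> * disc_deriv \<phi> w) \<in> Dinf_disc"
      by (rule Dinf_cmult[OF Dinf_disc_deriv[OF \<phi>]])
  qed
  also have "\<dots> = (\<Sum>i\<le>n. of_real t * (of_nat (n choose i) * (\<beta> * (disc_deriv ^^ Suc i) \<phi> z) *
       (disc_deriv ^^ (n - i)) ?E z))"
    by (simp only: disc_deriv_pow_cmult[OF Dinf_disc_deriv[OF \<phi>] z] funpow_Suc_right o_apply)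
      (simp only: mult_ac)
  finally show ?thesis by (simp only: sum_distrib_left)
qed

text \<open>
  For a fixed order, the derivatives of the composite grow at most polynomially in \<open>t\<close>, with constants
  independent of \<open>t\<close>.
\<close>

lemma peak_exp_compose_bound:
  assumes \<phi>: "\<phi> \<in> Dinf_disc" and \<beta>: "norm \<beta> = 1"
    and E: "\<And>t. 0 \<le> t \<Longrightarrow> peak_exp \<beta> t \<circ> \<phi> \<in> Dinf_disc"
    and le: "\<And>z. z \<in> cball 0 1 \<Longrightarrow> norm (\<phi> z) \<le> 1"
  shows "\<exists>K\<ge>0. \<forall>t\<ge>0. \<forall>z\<in>cball 0 1.
    norm ((disc_deriv ^^ n) (peak_exp \<beta> t \<circ> \<phi>) z) \<le> K * (1 + t) ^ n"
proof (induction n rule: less_induct)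
  case (less n)
  show ?case
  proof (cases n)
    case 0
    then show ?thesis using norm_peak_exp_le[OF \<beta>] le by (intro exI[of _ 1]) auto
  next
    case (Suc m)
    let ?E = "\<lambda>t. peak_exp \<beta> t \<circ> \<phi>"
    define S where "S j = disc_sup_norm ((disc_deriv ^^ j) \<phi>)" for j
    have S: "norm ((disc_deriv ^^ j) \<phi> z) \<le> S j" if "z \<in> cball 0 1" for j z
      unfolding S_def by (rule norm_le_disc_sup_norm[OF \<phi> that])
    have S0: "0 \<le> S j" for j by (rule order_trans[OF norm_ge_zero S[of 0]]) simp
    have "\<exists>K. \<forall>i\<le>m. 0 \<le> K i \<and> (\<forall>t\<ge>0. \<forall>z\<in>cball 0 1.
        norm ((disc_deriv ^^ i) (?E t) z) \<le> K i * (1 + t) ^ i)"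
      using less.IH Suc by (intro choice) (metis le_imp_less_Suc)
    then obtain K where K0: "\<And>i. i \<le> m \<Longrightarrow> 0 \<le> K i"
      and K: "\<And>i t z. i \<le> m \<Longrightarrow> 0 \<le> t \<Longrightarrow> z \<in> cball 0 1 \<Longrightarrow>
        norm ((disc_deriv ^^ i) (?E t) z) \<le> K i * (1 + t) ^ i" by blast
    define C where "C = (\<Sum>i\<le>m. real (m choose i) * S (Suc i) * K (m - i))"
    have C0: "0 \<le> C" unfolding C_def by (intro sum_nonneg mult_nonneg_nonneg S0 K0) auto
    have "norm ((disc_deriv ^^ Suc m) (?E t) z) \<le> C * (1 + t) ^ Suc m"
      if t: "0 \<le> t" and z: "z \<in> cball 0 1" for t z
    proof -
      have "norm (\<Sum>i\<le>m. of_nat (m choose i) * (\<beta> * (disc_deriv ^^ Suc i) \<phi> z) *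
          (disc_deriv ^^ (m - i)) (?E t) z)
        \<le> (\<Sum>i\<le>m. real (m choose i) * S (Suc i) * (K (m - i) * (1 + t) ^ m))"
      proof (rule sum_norm_le)
        fix i assume "i \<in> {..m}"
        have "norm ((disc_deriv ^^ (m - i)) (?E t) z) \<le> K (m - i) * (1 + t) ^ (m - i)"
          by (rule K) (use t z in auto)
        also have "\<dots> \<le> K (m - i) * (1 + t) ^ m"
          using t by (intro mult_left_mono power_increasing K0) auto
        finally have 1: "norm ((disc_deriv ^^ (m - i)) (?E t) z) \<le> K (m - i) * (1 + t) ^ m" .
        have "norm (of_nat (m choose i) * (\<beta> * (disc_deriv ^^ Suc i) \<phi> z) * (disc_deriv ^^ (m - i)) (?E t) z)
           = real (m choose i) * norm ((disc_deriv ^^ Suc i) \<phi> z) * norm ((disc_deriv ^^ (m - i)) (?E t) z)"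
          using \<beta> by (simp only: norm_mult norm_of_nat mult_1_left)
        also have "\<dots> \<le> real (m choose i) * S (Suc i) * (K (m - i) * (1 + t) ^ m)"
          by (intro mult_mono mult_left_mono S z 1 mult_nonneg_nonneg S0) auto
        finally show "norm (of_nat (m choose i) * (\<beta> * (disc_deriv ^^ Suc i) \<phi> z) * (disc_deriv ^^ (m - i)) (?E t) z)
           \<le> real (m choose i) * S (Suc i) * (K (m - i) * (1 + t) ^ m)" .
      qed
      also have "\<dots> = C * (1 + t) ^ m" by (simp add: C_def sum_distrib_right mult.assoc)
      finally have "norm ((disc_deriv ^^ Suc m) (?E t) z) \<le> t * (C * (1 + t) ^ m)"
        unfolding peak_exp_compose_rec[OF \<phi> E[OF t] z] norm_mult
        using t by (intro mult_mono) auto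
      also have "\<dots> \<le> (1 + t) * (C * (1 + t) ^ m)"
        using t C0 by (intro mult_right_mono) auto
      finally show ?thesis by (simp add: mult_ac)
    qed
    then show ?thesis using C0 Suc by blast
  qed
qed

lemma normalised_peak_exp:
  assumes na: "nonanalytic M" and M: "\<And>n. 0 < M n" and \<beta>: "norm \<beta> = 1" and t: "0 \<le> t"
    and G: "0 < weight_series M t"
  defines "u \<equiv> \<lambda>z. of_real (1 / weight_series M t) * peak_exp \<beta> t z"
  shows "u \<in> D_disc M" "D_disc_norm M u \<le> 1"
proof -
  let ?G = "weight_series M t"
  have u: "u \<in> Dinf_disc" unfolding u_def by (rule Dinf_cmult[OF peak_exp_Dinf])
  have sm: "summable (\<lambda>n. t ^ n / M n / ?G)"
    by (rule summable_divide[OF summable_weight_series[OF na M t]])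
  have le: "norm ((disc_deriv ^^ n) u z) \<le> M n * (t ^ n / M n / ?G)" if z: "z \<in> cball 0 1" for n z
  proof -
    have "norm ((disc_deriv ^^ n) u z) = norm ((disc_deriv ^^ n) (peak_exp \<beta> t) z) / ?G"
      unfolding u_def disc_deriv_pow_cmult[OF peak_exp_Dinf z] norm_mult norm_of_real using G by simp
    also have "\<dots> \<le> t ^ n / ?G"
      using norm_disc_deriv_peak_exp_le[OF \<beta> t z] G by (intro divide_right_mono) auto
    finally show ?thesis using less_imp_neq[OF M[of n]] by simp
  qed
  show uD: "u \<in> D_disc M" by (rule D_discI[OF u M sm le])
  have "D_disc_norm M u \<le> (\<Sum>n. t ^ n / M n / ?G)"
    unfolding D_disc_norm_def
  proof (rule suminf_le[OF _ _ sm])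
    show "summable (\<lambda>n. disc_sup_norm ((disc_deriv ^^ n) u) / M n)"
      using uD by (simp add: D_disc_def)
    show "disc_sup_norm ((disc_deriv ^^ n) u) / M n \<le> t ^ n / M n / ?G" for n
    proof -
      have "disc_sup_norm ((disc_deriv ^^ n) u) \<le> M n * (t ^ n / M n / ?G)"
        by (rule disc_sup_norm_le[OF le])
      then show ?thesis by (simp only: pos_divide_le_eq[OF M] mult.commute)
    qed
  qed
  also have "\<dots> = 1"
    using suminf_divide[OF summable_weight_series[OF na M t], of ?G] G
    by (simp add: weight_series_def)
  finally show "D_disc_norm M u \<le> 1" .
qed

text \<open>
  For a fixed order, the derivatives of the composites of the normalised exponentials are bounded
  uniformly in \<open>t\<close>, since the weight series dominates every power of \<open>t\<close>.
\<close>

lemma peak_exp_compose_normalised_bound: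
  assumes na: "nonanalytic M" and M: "\<And>n. 0 < M n" "M 0 = 1"
    and \<phi>: "\<phi> \<in> Dinf_disc" and \<beta>: "norm \<beta> = 1"
    and E: "\<And>t. 0 \<le> t \<Longrightarrow> peak_exp \<beta> t \<circ> \<phi> \<in> Dinf_disc"
    and le: "\<And>z. z \<in> cball 0 1 \<Longrightarrow> norm (\<phi> z) \<le> 1"
  shows "\<exists>K. \<forall>t\<ge>0. \<forall>z\<in>cball 0 1.
    norm ((disc_deriv ^^ n) (peak_exp \<beta> t \<circ> \<phi>) z) \<le> K * weight_series M t"
proof -
  obtain K where K0: "0 \<le> K"
    and K: "\<And>t z. 0 \<le> t \<Longrightarrow> z \<in> cball 0 1 \<Longrightarrow>
      norm ((disc_deriv ^^ n) (peak_exp \<beta> t \<circ> \<phi>) z) \<le> K * (1 + t) ^ n"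
    using peak_exp_compose_bound[OF \<phi> \<beta> E le, of n] by blast
  have "norm ((disc_deriv ^^ n) (peak_exp \<beta> t \<circ> \<phi>) z) \<le> K * (2 ^ n * (1 + M n)) * weight_series M t"
    if t: "0 \<le> t" and z: "z \<in> cball 0 1" for t z
  proof -
    let ?G = "weight_series M t"
    have G1: "1 \<le> ?G" using weight_series_ge_1[OF na M t] .
    have "(1 + t) ^ n \<le> (2 * max 1 t) ^ n" using t by (intro power_mono) auto
    also have "\<dots> = 2 ^ n * max 1 t ^ n" by (rule power_mult_distrib)
    also have "max 1 t ^ n \<le> (1 + M n) * ?G"
    proof (cases "t \<le> 1")
      case True
      then have "max 1 t ^ n = 1" by simp
      then show ?thesis using G1 M(1)[of n] mult_mono[of 1 "1 + M n" 1 ?G] by simp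
    next
      case False
      have "t ^ n \<le> M n * ?G"
        using weight_series_ge_term[OF na M(1) t, of n] M(1)[of n] by (simp add: field_simps)
      also have "\<dots> \<le> (1 + M n) * ?G" using G1 by (intro mult_right_mono) auto
      finally show ?thesis using False by (simp add: max_def)
    qed
    finally have "K * (1 + t) ^ n \<le> K * (2 ^ n * ((1 + M n) * ?G))"
      using K0 by (intro mult_left_mono) auto
    then show ?thesis using K[OF t z] by (simp add: mult_ac)
  qed
  then show ?thesis by blast
qed

text \<open>
  The derivatives at a point of \<open>exp (t * \<psi>)\<close>, for \<open>\<psi>\<close> with derivatives \<open>p\<close> there, obey this recurrence. As long
  as the order \<open>n\<close> is at most \<open>\<delta> * t\<close> and each derivative so far is at least \<open>t\<close> times its
  predecessor in modulus, the terms of the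
  sum with \<open>i > 0\<close> are dominated by a geometric series with a small ratio, and the leading term gives
  the next derivative a gain of \<open>c * t\<close>.
\<close>

lemma recurrence_lower_bound:
  fixes a p :: "nat \<Rightarrow> complex" and t c B R \<delta> :: real
  assumes rec: "\<And>n. a (Suc n) = of_real t * (\<Sum>i\<le>n. of_nat (n choose i) * p (Suc i) * a (n - i))"
    and p: "\<And>j. norm (p j) \<le> fact j * B * R ^ j"
    and pos: "0 < t" "0 < R" "0 \<le> B" "0 \<le> \<delta>"
    and c: "1 \<le> c" "c + 4 * B * R\<^sup>2 * \<delta> \<le> norm (p 1)"
    and \<delta>: "4 * R * \<delta> \<le> 1"
    and n: "real n \<le> \<delta> * t"
  shows "(c * t) ^ n * norm (a 0) \<le> norm (a n)"
proof -
  have step: "c * t * norm (a n) \<le> norm (a (Suc n))" if "real n \<le> \<delta> * t" for n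
    using that
  proof (induction n rule: less_induct)
    case (less n)
    define q where "q = 2 * R * real n / t"
    have q: "0 \<le> q" "q \<le> 2 * R * \<delta>"
      using pos less.prems by (auto simp: q_def field_simps)
    have q2: "q \<le> 1/2" using q \<delta> by simp
    have earlier: "norm (a (n - i)) * t ^ i \<le> norm (a n)" if "i \<le> n" for i
      using that
    proof (induction i)
      case (Suc i)
      have "norm (a (n - Suc i)) * t \<le> c * t * norm (a (n - Suc i))"
        using c pos mult_right_mono[of 1 c "t * norm (a (n - Suc i))"] by (simp add: mult_ac)
      also have "\<dots> \<le> norm (a (Suc (n - Suc i)))"
        using Suc.prems less.prems by (intro less.IH) auto
      also have "Suc (n - Suc i) = n - i" using Suc.prems by simp
      finally have "norm (a (n - Suc i)) * t * t ^ i \<le> norm (a (n - i)) * t ^ i"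
        using pos by (intro mult_right_mono) auto
      then show ?case using Suc by (simp add: mult_ac)
    qed simp
    have summand: "norm (of_nat (n choose i) * p (Suc i) * a (n - i)) \<le> B * R * q ^ i * norm (a n)"
      if "i \<le> n" for i
    proof -
      have "real (n choose i) * fact (Suc i) \<le> (2 * real n) ^ i"
      proof -
        have "(n choose i) * fact i \<le> n ^ i" by (rule binomial_fact_pow)
        then have "real (n choose i) * fact i \<le> real n ^ i"
          by (metis of_nat_fact of_nat_le_iff of_nat_mult of_nat_power)
        moreover have "1 + real i \<le> 2 ^ i"
          using Suc_leI[OF less_exp[of i]] by (metis of_nat_Suc of_nat_le_iff of_nat_numeral of_nat_power)
        ultimately have "(real (n choose i) * fact i) * (1 + real i) \<le> real n ^ i * 2 ^ i"
          by (intro mult_mono) auto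
        then show ?thesis by (simp add: power_mult_distrib mult_ac)
      qed
      then have "real (n choose i) * (fact (Suc i) * B * R ^ Suc i) \<le> (2 * real n) ^ i * (B * R ^ Suc i)"
        using pos mult_right_mono[of "real (n choose i) * fact (Suc i)" "(2 * real n) ^ i" "B * R ^ Suc i"]
        by (simp only: mult.assoc) simp
      moreover have "real (n choose i) * norm (p (Suc i)) \<le> real (n choose i) * (fact (Suc i) * B * R ^ Suc i)"
        by (intro mult_left_mono p) auto
      ultimately have 1: "real (n choose i) * norm (p (Suc i)) \<le> (2 * real n) ^ i * (B * R ^ Suc i)"
        by linarith
      have "norm (of_nat (n choose i) * p (Suc i) * a (n - i)) =
         real (n choose i) * norm (p (Suc i)) * (norm (a (n - i)) * t ^ i) / t ^ i"
        using pos by (simp add: norm_mult)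
      also have "\<dots> \<le> (2 * real n) ^ i * (B * R ^ Suc i) * norm (a n) / t ^ i"
        using pos by (intro divide_right_mono mult_mono 1 earlier that) auto
      also have "\<dots> = B * R * q ^ i * norm (a n)"
        by (simp add: q_def power_mult_distrib power_divide mult_ac)
      finally show ?thesis .
    qed
    have geo: "(\<Sum>i<n. q ^ Suc i) \<le> 4 * R * \<delta>"
    proof -
      have "(\<Sum>i<n. q ^ i) \<le> (\<Sum>i. q ^ i)"
        using q q2 by (intro sum_le_suminf summable_geometric) auto
      also have "\<dots> = 1 / (1 - q)" using q q2 by (intro suminf_geometric) auto
      also have "\<dots> \<le> 2" using q2 by (simp add: field_simps)
      finally have "q * (\<Sum>i<n. q ^ i) \<le> q * 2" using q by (intro mult_left_mono) auto
      then show ?thesis using q by (simp add: sum_distrib_left)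
    qed
    have "norm (\<Sum>i<n. of_nat (n choose Suc i) * p (Suc (Suc i)) * a (n - Suc i))
        \<le> (\<Sum>i<n. B * R * q ^ Suc i * norm (a n))"
      by (rule sum_norm_le, rule summand) auto
    also have "\<dots> = B * R * norm (a n) * (\<Sum>i<n. q ^ Suc i)"
      by (simp add: sum_distrib_left mult_ac)
    also have "\<dots> \<le> B * R * norm (a n) * (4 * R * \<delta>)"
      using pos geo by (intro mult_left_mono) auto
    finally have tail: "norm (\<Sum>i<n. of_nat (n choose Suc i) * p (Suc (Suc i)) * a (n - Suc i))
        \<le> 4 * B * R\<^sup>2 * \<delta> * norm (a n)" by (simp add: power2_eq_square mult_ac)
    have split: "(\<Sum>i\<le>n. of_nat (n choose i) * p (Suc i) * a (n - i)) =
        p 1 * a n + (\<Sum>i<n. of_nat (n choose Suc i) * p (Suc (Suc i)) * a (n - Suc i))"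
      by (subst sum.atMost_shift) simp
    have "c * norm (a n) \<le> (norm (p 1) - 4 * B * R\<^sup>2 * \<delta>) * norm (a n)"
      using c by (intro mult_right_mono) auto
    also have "\<dots> \<le> norm (p 1 * a n) - norm (\<Sum>i<n. of_nat (n choose Suc i) * p (Suc (Suc i)) * a (n - Suc i))"
      using tail by (simp add: norm_mult left_diff_distrib)
    also have "\<dots> \<le> norm (\<Sum>i\<le>n. of_nat (n choose i) * p (Suc i) * a (n - i))"
      unfolding split by (rule norm_diff_ineq)
    finally show ?case using pos by (simp add: rec norm_mult mult_ac)
  qed
  show ?thesis
    using n
  proof (induction n)
    case (Suc n)
    have "(c * t) ^ Suc n * norm (a 0) = c * t * ((c * t) ^ n * norm (a 0))" by simp
    also have "\<dots> \<le> c * t * norm (a n)"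
      using Suc c pos by (intro mult_left_mono) auto
    also have "\<dots> \<le> norm (a (Suc n))" using Suc by (intro step) auto
    finally show ?case .
  qed simp
qed

text \<open>
  An expanding point at which the exponentials peak makes the composition operator unbounded
  on them, and finitely many derivatives at that single point suffice to see it.
\<close>

lemma peak_exp_compose_growth:
  assumes na: "nonanalytic M" and M: "\<And>n. 0 < M n" "M 0 = 1"
    and \<phi>: "\<phi> \<in> Dinf_disc" and \<beta>: "norm \<beta> = 1" "\<beta> * \<phi> a = 1" and a: "a \<in> cball 0 1"
    and E: "\<And>t. 0 \<le> t \<Longrightarrow> peak_exp \<beta> t \<circ> \<phi> \<in> Dinf_disc"
    and a1: "1 < norm (disc_deriv \<phi> a)"
    and R: "0 < R" and B: "0 \<le> B"
    and bd: "\<And>j. norm ((disc_deriv ^^ j) \<phi> a) \<le> fact j * B * R ^ j"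
  shows "\<exists>(k::nat) N. L * weight_series M k \<le>
    (\<Sum>n\<le>N. norm ((disc_deriv ^^ n) (peak_exp \<beta> k \<circ> \<phi>) a) / M n)"
proof -
  define d where "d = norm (disc_deriv \<phi> a)"
  \<comment> \<open>Any c strictly between 1 and d would do; the margin d - c pays for the lower order terms.\<close>
  define c where "c = (1 + d) / 2"
  have c: "1 < c" "c < d" using a1 by (simp_all add: c_def d_def)
  define \<delta> where "\<delta> = min (1 / (4 * R)) ((d - c) / (4 * B * R\<^sup>2 + 1))"
  have Bpos: "0 < 4 * B * R\<^sup>2 + 1" using B by (intro add_nonneg_pos) auto
  have \<delta>0: "0 < \<delta>" using R c Bpos by (simp add: \<delta>_def)
  have \<delta>1: "4 * R * \<delta> \<le> 1"
  proof -
    have "\<delta> \<le> 1 / (4 * R)" by (simp add: \<delta>_def)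
    then show ?thesis using R by (simp add: field_simps)
  qed
  have \<delta>2: "c + 4 * B * R\<^sup>2 * \<delta> \<le> d"
  proof -
    have "\<delta> \<le> (d - c) / (4 * B * R\<^sup>2 + 1)" by (simp add: \<delta>_def)
    then have "\<delta> * (4 * B * R\<^sup>2 + 1) \<le> d - c" using Bpos by (simp add: pos_le_divide_eq)
    then show ?thesis using \<delta>0 by (simp add: algebra_simps)
  qed
  obtain k :: nat where k: "0 < k" and
    grow: "L * weight_series M k \<le> (\<Sum>n\<le>nat \<lfloor>\<delta> * real k\<rfloor>. (c * real k) ^ n / M n)"
    using weight_series_growth[OF na M \<delta>0 c(1), of L] by blast
  define N where "N = nat \<lfloor>\<delta> * real k\<rfloor>"
  have low: "(c * real k) ^ n \<le> norm ((disc_deriv ^^ n) (peak_exp \<beta> k \<circ> \<phi>) a)" if "n \<le> N" for n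
  proof -
    have n: "real n \<le> \<delta> * real k"
      using that \<delta>0 unfolding N_def by (simp add: le_nat_iff le_floor_iff)
    have "(c * real k) ^ n * norm ((disc_deriv ^^ 0) (peak_exp \<beta> k \<circ> \<phi>) a)
        \<le> norm ((disc_deriv ^^ n) (peak_exp \<beta> k \<circ> \<phi>) a)"
    proof (rule recurrence_lower_bound[where p = "\<lambda>j. \<beta> * (disc_deriv ^^ j) \<phi> a"
          and B = B and R = R and \<delta> = \<delta>])
      show "(disc_deriv ^^ Suc n) (peak_exp \<beta> k \<circ> \<phi>) a = of_real (real k) *
        (\<Sum>i\<le>n. of_nat (n choose i) * (\<beta> * (disc_deriv ^^ Suc i) \<phi> a) *
          (disc_deriv ^^ (n - i)) (peak_exp \<beta> k \<circ> \<phi>) a)" for n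
        by (rule peak_exp_compose_rec[OF \<phi> E a]) simp
      show "norm (\<beta> * (disc_deriv ^^ j) \<phi> a) \<le> fact j * B * R ^ j" for j
        using bd[of j] \<beta> by (simp add: norm_mult)
      show "c + 4 * B * R\<^sup>2 * \<delta> \<le> norm (\<beta> * (disc_deriv ^^ 1) \<phi> a)"
        using \<delta>2 \<beta> by (simp add: norm_mult d_def)
    qed (use k R B c \<delta>0 \<delta>1 n in auto)
    then show ?thesis by (simp add: peak_exp_def \<beta>)
  qed
  have "(\<Sum>n\<le>N. (c * real k) ^ n / M n) \<le> (\<Sum>n\<le>N. norm ((disc_deriv ^^ n) (peak_exp \<beta> k \<circ> \<phi>) a) / M n)"
    by (intro sum_mono divide_right_mono low) (auto intro: less_imp_le[OF M(1)])
  with grow show ?thesis unfolding N_def by (meson order_trans)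
qed

section \<open>Inner functions and endomorphisms\<close>

theorem theorem6:
  fixes M :: "nat \<Rightarrow> real" and \<phi> :: "complex \<Rightarrow> complex"
  assumes "weight_sequence M" and "nonanalytic M"
    and "inner_function \<phi>" and "\<phi> \<in> D_disc M"
    and "\<not> \<phi> constant_on cball 0 1" and "\<not> is_rotation \<phi>"
  shows "\<not> induces_endomorphism M \<phi>"
proof
  assume endo: "induces_endomorphism M \<phi>"
  have M: "\<And>n. 0 < M n" "M 0 = 1" using assms(1) by (auto simp: weight_sequence_def)
  have \<phi>: "\<phi> \<in> Dinf_disc" using assms(4) by (simp add: D_disc_def)
  have cont: "continuous_on (cball 0 1) \<phi>" using Dinf_continuous_on[OF \<phi>, of 0] by simp
  have hol: "\<phi> holomorphic_on ball 0 1" using assms(3) by (simp add: inner_function_def)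
  have uni: "\<And>z. norm z = 1 \<Longrightarrow> norm (\<phi> z) = 1"
    by (rule inner_function_unimodular[OF assms(3) cont])
  have le: "\<And>z. z \<in> cball 0 1 \<Longrightarrow> norm (\<phi> z) \<le> 1"
    using endo by (auto simp: induces_endomorphism_def image_subset_iff)
  have comp: "\<And>f. f \<in> D_disc M \<Longrightarrow> f \<circ> \<phi> \<in> D_disc M"
    using endo by (auto simp: induces_endomorphism_def)
  obtain a where a: "norm a = 1" and a1: "1 < norm (disc_deriv \<phi> a)"
    using expanding_boundary_point[OF hol \<phi> le uni assms(5,6)] by blast
  have ac: "a \<in> cball 0 1" using a by simp
  obtain B R where R: "0 < R" and B: "0 \<le> B"
    and bd: "\<And>j. norm ((disc_deriv ^^ j) \<phi> a) \<le> fact j * B * R ^ j"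
    using boundary_derivative_bounds[OF hol cont uni a] by blast
  define \<beta> where "\<beta> = cnj (\<phi> a)"
  have \<beta>: "norm \<beta> = 1" "\<beta> * \<phi> a = 1"
    using uni[OF a] complex_norm_square[of "\<phi> a"] by (simp_all add: \<beta>_def mult.commute)
  have ED: "peak_exp \<beta> t \<circ> \<phi> \<in> D_disc M" if "0 \<le> t" for t
    using comp[OF peak_exp_D_disc[OF assms(2) M(1) \<beta>(1) that]] .
  then have EDinf: "peak_exp \<beta> t \<circ> \<phi> \<in> Dinf_disc" if "0 \<le> t" for t
    using that by (simp add: D_disc_def)
  define E where "E k = peak_exp \<beta> (real k) \<circ> \<phi>" for k
  define G where "G k = weight_series M (real k)" for k
  have Gpos: "0 < G k" for k
    using weight_series_ge_1[OF assms(2) M, of "real k"] by (simp add: G_def)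
  have "\<forall>n. \<exists>K. \<forall>k. \<forall>z\<in>cball 0 1. norm ((disc_deriv ^^ n) (E k) z) \<le> K * G k"
    unfolding E_def G_def
    using peak_exp_compose_normalised_bound[OF assms(2) M \<phi> \<beta>(1) EDinf le]
    by (meson of_nat_0_le_iff)
  then obtain K where K: "\<And>n k z. z \<in> cball 0 1 \<Longrightarrow> norm ((disc_deriv ^^ n) (E k) z) \<le> K n * G k"
    by metis
  \<comment> \<open>Row k collects the weighted derivatives at a of the k-th composite, divided by the norm of the
      k-th exponential.\<close>
  define x where "x k n = (disc_deriv ^^ n) (E k) a / of_real (G k) / of_real (M n)" for k n
  have nx: "norm (x k n) = norm ((disc_deriv ^^ n) (E k) a) / M n / G k" for k n
    by (simp only: x_def norm_divide norm_of_real abs_of_pos[OF Gpos] abs_of_pos[OF M(1)])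
      (simp add: mult.commute)
  have S: "summable (\<lambda>n. norm (x k n))" for k
    unfolding nx E_def by (intro summable_divide D_disc_summable_at ED M(1) ac) auto
  have Bx: "norm (x k n) \<le> K n / M n" for k n
  proof -
    have "norm ((disc_deriv ^^ n) (E k) a) / M n / G k \<le> K n * G k / M n / G k"
      using K[OF ac] M(1)[of n] Gpos[of k] by (intro divide_right_mono) auto
    then show ?thesis using less_imp_neq[OF Gpos[of k]] by (simp add: nx)
  qed
  have unb: "\<exists>k. L \<le> (\<Sum>n. norm (x k n))" for L
  proof -
    obtain k N where kN: "L * G k \<le> (\<Sum>n\<le>N. norm ((disc_deriv ^^ n) (E k) a) / M n)"
      unfolding G_def E_def
      using peak_exp_compose_growth[OF assms(2) M \<phi> \<beta> ac EDinf a1 R B bd] by blast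
    have "L \<le> (\<Sum>n\<le>N. norm ((disc_deriv ^^ n) (E k) a) / M n) / G k"
      using kN Gpos[of k] by (simp add: pos_le_divide_eq)
    also have "\<dots> = (\<Sum>n\<le>N. norm (x k n))" unfolding nx by (rule sum_divide_distrib)
    also have "\<dots> \<le> (\<Sum>n. norm (x k n))" by (rule sum_le_suminf[OF S]) auto
    finally show ?thesis by blast
  qed
  obtain \<alpha> :: "nat \<Rightarrow> real" and k :: "nat \<Rightarrow> nat"
    where \<alpha>: "\<And>j. 0 \<le> \<alpha> j" "summable \<alpha>"
      and div: "\<not> summable (\<lambda>n. norm (\<Sum>j. of_real (\<alpha> j) * x (k j) n))"
    using gliding_hump[OF S Bx unb] by blast
  \<comment> \<open>The superposition f lies in the algebra, and the weighted derivatives of its composite at a are the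
      sums that fail to be summable.\<close>
  define u where "u j z = of_real (1 / G (k j)) * peak_exp \<beta> (real (k j)) z" for j z
  define v where "v j z = of_real (1 / G (k j)) * E (k j) z" for j z
  define f where "f z = (\<Sum>j. of_real (\<alpha> j) * u j z)" for z
  have u: "u j \<in> D_disc M" "D_disc_norm M (u j) \<le> 1" for j
    using normalised_peak_exp[OF assms(2) M(1) \<beta>(1) _ Gpos[unfolded G_def], of "k j"]
    by (simp_all only: u_def[abs_def] G_def of_nat_0_le_iff)
  have fD: "f \<in> D_disc M"
    unfolding f_def[abs_def] by (rule D_disc_suminf[OF M(1) u \<alpha>])
  have EDinf': "E k \<in> Dinf_disc" for k unfolding E_def by (rule EDinf) simp
  have vD: "v j \<in> Dinf_disc" for j unfolding v_def[abs_def] by (rule Dinf_cmult[OF EDinf'])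
  have dv: "(disc_deriv ^^ n) (v j) z = (disc_deriv ^^ n) (E (k j)) z / of_real (G (k j))"
    if "z \<in> cball 0 1" for n j z
    unfolding v_def[abs_def] disc_deriv_pow_cmult[OF EDinf' that] by simp
  have vK: "norm ((disc_deriv ^^ n) (v j) z) \<le> K n" if "z \<in> cball 0 1" for n j z
    using K[OF that, of n "k j"] Gpos[of "k j"]
    by (simp add: dv[OF that] norm_divide pos_divide_le_eq)
  have fphi: "f \<circ> \<phi> = (\<lambda>z. \<Sum>j. of_real (\<alpha> j) * v j z)"
    by (simp add: fun_eq_iff f_def u_def v_def E_def)
  have "(disc_deriv ^^ n) (f \<circ> \<phi>) a / of_real (M n) = (\<Sum>j. of_real (\<alpha> j) * x (k j) n)" for n
  proof -
    have "summable (\<lambda>j. of_real (\<alpha> j) * (disc_deriv ^^ n) (v j) a)"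
    proof (rule summable_comparison_test'[OF summable_mult2[OF \<alpha>(2), of "K n"], of 0])
      fix j show "norm (of_real (\<alpha> j) * (disc_deriv ^^ n) (v j) a) \<le> \<alpha> j * K n"
        using vK[OF ac] \<alpha>(1)[of j] by (simp add: norm_mult mult_left_mono)
    qed
    from suminf_divide[OF this, of "of_real (M n)"]
    have "(\<Sum>j. of_real (\<alpha> j) * (disc_deriv ^^ n) (v j) a) / of_real (M n) =
        (\<Sum>j. of_real (\<alpha> j) * x (k j) n)"
      by (simp add: dv[OF ac] x_def)
    moreover have "(disc_deriv ^^ n) (f \<circ> \<phi>) a = (\<Sum>j. of_real (\<alpha> j) * (disc_deriv ^^ n) (v j) a)"
      unfolding fphi by (rule disc_deriv_pow_suminf(2)[of v K \<alpha>, OF vD vK \<alpha> ac])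
    ultimately show ?thesis by simp
  qed
  then have "norm (\<Sum>j. of_real (\<alpha> j) * x (k j) n) = norm ((disc_deriv ^^ n) (f \<circ> \<phi>) a) / M n" for n
    by (metis M(1) abs_of_pos norm_divide norm_of_real)
  then have "summable (\<lambda>n. norm (\<Sum>j. of_real (\<alpha> j) * x (k j) n))"
    using D_disc_summable_at[OF comp[OF fD] M(1) ac] by simp
  with div show False by blast
qed

end
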